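(* Let $p$ be a prime, let $S$ be a finitely generated (abstract) free group and let $n\geq1$. Then: (a) $S_{(n)}$ is the intersection of the kernels of all group homomorphisms $\rho\colon S\to\mathrm{U}_n(\mathbb{F}_p)$; (b) $S_n$ is the intersection of the kernels of all group homomorphisms $\rho\colon S\to\mathrm{U}_n(\mathbb{Z})$; (c) $S^{(n)}$ is the intersection of the kernels of all group homomorphisms $\rho\colon S\to\mathrm{U}_{k+1}(\mathbb{Z}/p^{n-k}\mathbb{Z})$, where $k$ ranges over $1,\ldots,n-1$.
   Context: For a commutative unital ring $\Lambda$, $\mathrm{U}_m(\Lambda)$ is the group of upper-triangular unipotent $m\times m$ matrices over $\Lambda$. For an abstract group $G$: $G_1=G$, $G_{i+1}=[G_i,G]$ (descending central series); $G^{(1)}=G$, $G^{(i+1)}=(G^{(i)})^p[G^{(i)},G]$ (descending $p$-central series); $G_{(1)}=G$, $G_{(n)}=G_{(\lceil n/p\rceil)}^p\prod_{i+j=n}[G_{(i)},G_{(j)}]$ ($p$-Zassenhaus filtration), where $[H,K]$ is the subgroup generated by commutators $x^{-1}y^{-1}xy$ with $x\in H$, $y\in K$, and $H^p$ the subgroup generated by $p$-th powers of elements of $H$. *)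

theory Defs
  imports "HOL-Algebra.Algebra" "HOL-Number_Theory.Residues"
begin

fun eval_word :: "('a, 'b) monoid_scheme \<Rightarrow> (bool \<times> 'a) list \<Rightarrow> 'a" where
  "eval_word G [] = \<one>\<^bsub>G\<^esub>"
| "eval_word G ((e, x) # w) =
     (if e then x else inv\<^bsub>G\<^esub> x) \<otimes>\<^bsub>G\<^esub> eval_word G w"

fun reduced_word :: "(bool \<times> 'a) list \<Rightarrow> bool" where
  "reduced_word [] = True"
| "reduced_word [_] = True"
| "reduced_word ((e, x) # (f, y) # w) =
     (\<not> (x = y \<and> e \<noteq> f) \<and> reduced_word ((f, y) # w))"

definition free_group_on :: "('a, 'b) monoid_scheme \<Rightarrow> 'a set \<Rightarrow> bool" where
  "free_group_on S B \<longleftrightarrow> group S \<and> B \<subseteq> carrier S \<and> generate S B = carrier S \<and>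
     (\<forall>w. w \<noteq> [] \<and> reduced_word w \<and> snd ` set w \<subseteq> B \<longrightarrow> eval_word S w \<noteq> \<one>\<^bsub>S\<^esub>)"

definition fg_free_group :: "('a, 'b) monoid_scheme \<Rightarrow> bool" where
  "fg_free_group S \<longleftrightarrow> (\<exists>B. finite B \<and> free_group_on S B)"

definition comm_sub :: "('a, 'b) monoid_scheme \<Rightarrow> 'a set \<Rightarrow> 'a set \<Rightarrow> 'a set" where
  "comm_sub G H K = generate G
     {inv\<^bsub>G\<^esub> x \<otimes>\<^bsub>G\<^esub> inv\<^bsub>G\<^esub> y \<otimes>\<^bsub>G\<^esub> x \<otimes>\<^bsub>G\<^esub> y | x y. x \<in> H \<and> y \<in> K}"

definition ppowers :: "('a, 'b) monoid_scheme \<Rightarrow> nat \<Rightarrow> 'a set \<Rightarrow> 'a set" where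
  "ppowers G p H = {x [^]\<^bsub>G\<^esub> p | x. x \<in> H}"

text \<open>Descending central series, indexed from 1: lower_central G 1 = carrier G.\<close>
fun lower_central :: "('a, 'b) monoid_scheme \<Rightarrow> nat \<Rightarrow> 'a set" where
  "lower_central G 0 = carrier G"
| "lower_central G (Suc 0) = carrier G"
| "lower_central G (Suc (Suc i)) = comm_sub G (lower_central G (Suc i)) (carrier G)"

text \<open>Descending p-central series, indexed from 1; H^p [H,G] is the subgroup generated by both.\<close>
fun p_central :: "('a, 'b) monoid_scheme \<Rightarrow> nat \<Rightarrow> nat \<Rightarrow> 'a set" where
  "p_central G p 0 = carrier G"
| "p_central G p (Suc 0) = carrier G"
| "p_central G p (Suc (Suc i)) =
     generate G (ppowers G p (p_central G p (Suc i)) \<union> comm_sub G (p_central G p (Suc i)) (carrier G))"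

text \<open>p-Zassenhaus filtration, indexed from 1;
  G_(n) = G_(ceil(n/p))^p * prod_{i+j=n} [G_(i), G_(j)] for n \<ge> 2 (here i, j \<ge> 1).
  The guard on p only ensures termination; it is irrelevant for primes p.\<close>
function zassenhaus :: "('a, 'b) monoid_scheme \<Rightarrow> nat \<Rightarrow> nat \<Rightarrow> 'a set" where
  "zassenhaus G p n =
    (if n \<le> 1 then carrier G
     else generate G
       (ppowers G p (zassenhaus G p (if 2 \<le> p then (n + p - 1) div p else 1))
        \<union> (\<Union>i\<in>{1..<n}. comm_sub G (zassenhaus G p i) (zassenhaus G p (n - i)))))"
  by pat_completeness auto
termination
proof (relation "measure (\<lambda>(G, p, n). n)")
  show "wf (measure (\<lambda>(G, p, n). n))" by simp
next
  fix G :: "('a, 'b) monoid_scheme" and p n :: nat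
  assume "\<not> n \<le> 1"
  then show "((G, p, if 2 \<le> p then (n + p - 1) div p else 1), G, p, n) \<in> measure (\<lambda>(G, p, n). n)"
  proof (cases "2 \<le> p")
    case True
    have "2 * (n - 1) \<le> p * (n - 1)" using True by (rule mult_right_mono) simp
    moreover have "p * n = p + p * (n - 1)" using \<open>\<not> n \<le> 1\<close>
      by (metis le_add_diff_inverse mult.commute mult_Suc nat_le_linear plus_1_eq_Suc)
    ultimately have "n + p - 1 < p * n" using \<open>\<not> n \<le> 1\<close> by linarith
    then have "(n + p - 1) div p < n" using True
      by (simp add: div_less_iff_less_mult mult.commute)
    then show ?thesis using True by simp
  qed simp
qed auto

definition unitri :: "('a, 'c) ring_scheme \<Rightarrow> nat \<Rightarrow> (nat \<Rightarrow> nat \<Rightarrow> 'a) monoid" where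
  "unitri R m =
    \<lparr> carrier = {A. (\<forall>i j. i < m \<and> j < m \<longrightarrow> A i j \<in> carrier R)
                   \<and> (\<forall>i < m. A i i = \<one>\<^bsub>R\<^esub>)
                   \<and> (\<forall>i j. j < i \<and> i < m \<longrightarrow> A i j = \<zero>\<^bsub>R\<^esub>)
                   \<and> (\<forall>i j. \<not> (i < m \<and> j < m) \<longrightarrow> A i j = \<zero>\<^bsub>R\<^esub>)},
      monoid.mult = (\<lambda>A B i j. if i < m \<and> j < m
                         then (\<Oplus>\<^bsub>R\<^esub>k\<in>{..<m}. A i k \<otimes>\<^bsub>R\<^esub> B k j) else \<zero>\<^bsub>R\<^esub>),
      one = (\<lambda>i j. if i < m \<and> j < m \<and> i = j then \<one>\<^bsub>R\<^esub> else \<zero>\<^bsub>R\<^esub>) \<rparr>"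

definition hom_kernels :: "('a, 'b) monoid_scheme \<Rightarrow> ('c, 'd) monoid_scheme \<Rightarrow> 'a set" where
  "hom_kernels S H = carrier S \<inter> (\<Inter>\<rho>\<in>hom S H. kernel S H \<rho>)"

end

(* The Magnus representation x_j |-> 1 + X_j sends a free group S into the units with constant term 1 of
   the ring of noncommutative power series over the integers. On the one hand, every homomorphism from S
   to a unitriangular group factors through such a homomorphism and, for a word u = u_1 ... u_k, sending
   a series f to the matrix with (i,j) entry the coefficient of u_{i+1} ... u_j in f is a homomorphism.
   Hence the three intersections of kernels are the subgroups of those s whose Magnus coefficients at
   words of length k, 0 < k < n, are divisible by p, by 0, and by p^(n-k) respectively; these conditions
   define multiplicative filtrations, which contain the corresponding central series.

   For the converse, attach to each Lyndon word w an iterated commutator tau_w along the standard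
   factorization of w. A Hall-Witt rewriting argument shows that S is generated modulo the n-th term of
   the lower central series by the tau_w with w shorter than n, so every element has a normal form
   prod tau_w^(e_w). The Magnus series of tau_w is 1 + w + (larger terms), so tau_w^(e_w) has leading word
   w (or, modulo p, w^(p^v) where p^v is the exact power of p dividing e_w). As distinct factors have
   distinct leading words, the factors of lowest weight cannot cancel, and a coefficient condition on
   the product forces every single factor into the required term of the series. *)
theory Submission
  imports Defs "HOL-Library.List_Lexorder"
begin

section \<open>Lyndon words\<close>

text \<open>The obstacle is cancellation between the factors of a normal form. Let \<open>v\<close>
  be the least value of a factor, where the value of \<open>tau_w^e\<close> is the index of a term
  of the series in which it visibly lies: \<open>|w|\<close>, or \<open>|w| + v_p(e)\<close>, or
  \<open>p^(v_p(e)) |w|\<close>. Modulo step \<open>Suc v\<close> of the filtration the question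
  becomes linear: since \<open>v >= 1\<close>, a product of two deviations from 1 lies in step
  \<open>2 v\<close>, so the whole product is 1 plus the sum of the deviations. Distinct leading
  words make these summands a triangular system. Lyndon words serve twice. The inequality
  \<open>u @ v < v @ u\<close> for a standard factorization makes each bracket lead with its own
  word, with coefficient 1; and Lyndon words are primitive, so the powers that arise modulo
  \<open>p\<close> still determine the word. All three cases stay inside series over the integers
  and differ only in the divisor demanded of each coefficient, so one argument, parametrized by that
  divisor, serves them all. Containment of the central series in the kernels is proved for every
  homomorphism into the units; the converse evaluates only the Magnus one.\<close>

lemma lex_append_cancel: "u @ x < u @ y \<longleftrightarrow> x < (y :: 'a :: linorder list)"
  by (induction u) auto

lemma lex_less_append: "v \<noteq> [] \<Longrightarrow> u < u @ (v :: 'a :: linorder list)"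
  using lex_append_cancel[of u "[]" v] by (cases v) auto

text \<open>As \<open>u\<close> is not a prefix of \<open>v\<close>, the comparison is decided
  inside both words and no continuation can change it.\<close>

lemma lex_append_mono:
  "u < v \<Longrightarrow> (\<And>c. v \<noteq> u @ c) \<Longrightarrow> u @ x < v @ (y :: 'a :: linorder list)"
proof (induction u arbitrary: v)
  case (Cons a u)
  then obtain b v' where "v = b # v'" by (cases v) auto
  with Cons show ?case by auto
qed auto

lemma lex_append_mono_length:
  assumes "u < v" "length v \<le> length u"
  shows "u @ x < v @ (y :: 'a :: linorder list)"
proof (rule lex_append_mono[OF assms(1)])
  show "v \<noteq> u @ c" for c using assms by (cases c) auto
qed

definition lyndon :: "'a :: linorder list \<Rightarrow> bool" where
  "lyndon w \<longleftrightarrow> w \<noteq> [] \<and> (\<forall>a v. w = a @ v \<longrightarrow> a \<noteq> [] \<longrightarrow> v \<noteq> [] \<longrightarrow> w < v)"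

definition proper_suffixes :: "'a list \<Rightarrow> 'a list set" where
  "proper_suffixes w = {v. v \<noteq> [] \<and> (\<exists>a. a \<noteq> [] \<and> w = a @ v)}"

text \<open>For a Lyndon word the least proper suffix is also the longest proper Lyndon suffix, so
  this is the usual standard factorization. The minimum is meaningful from length 2 on.\<close>

definition std_right :: "'a :: linorder list \<Rightarrow> 'a list" where
  "std_right w = Min (proper_suffixes w)"

definition std_left :: "'a :: linorder list \<Rightarrow> 'a list" where
  "std_left w = take (length w - length (std_right w)) w"

lemma lyndon_altdef: "lyndon w \<longleftrightarrow> w \<noteq> [] \<and> (\<forall>v\<in>proper_suffixes w. w < v)"
  unfolding lyndon_def proper_suffixes_def by blast

lemma lyndon_singleton [simp]: "lyndon [x]"
  by (auto simp: lyndon_def append_eq_Cons_conv Cons_eq_append_conv)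

lemma lyndon_not_Nil [simp]: "\<not> lyndon []"
  by (simp add: lyndon_def)

lemma finite_proper_suffixes: "finite (proper_suffixes w)"
proof (rule finite_subset)
  show "proper_suffixes w \<subseteq> (\<lambda>i. drop i w) ` {..length w}"
  proof
    fix v assume "v \<in> proper_suffixes w"
    then obtain a where "w = a @ v" by (auto simp: proper_suffixes_def)
    then have "v = drop (length a) w" "length a \<le> length w" by auto
    then show "v \<in> (\<lambda>i. drop i w) ` {..length w}" by blast
  qed
qed auto

lemma std_right_in: "2 \<le> length w \<Longrightarrow> std_right w \<in> proper_suffixes w"
  and std_right_le: "v \<in> proper_suffixes w \<Longrightarrow> std_right w \<le> v"
proof -
  assume "2 \<le> length w"
  then have "drop 1 w \<in> proper_suffixes w"
    by (auto simp: proper_suffixes_def intro!: exI[of _ "take 1 w"])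
  then show "std_right w \<in> proper_suffixes w"
    unfolding std_right_def using finite_proper_suffixes by (intro Min_in) auto
qed (simp add: std_right_def finite_proper_suffixes)

lemma std_append:
  assumes "2 \<le> length w"
  shows "std_left w @ std_right w = w" "std_left w \<noteq> []" "std_right w \<noteq> []"
proof -
  from std_right_in[OF assms] obtain a where a: "a \<noteq> []" "std_right w \<noteq> []" "w = a @ std_right w"
    by (auto simp: proper_suffixes_def)
  then have "std_left w = a"
    unfolding std_left_def by (metis add_diff_cancel_right' append_eq_conv_conj length_append)
  with a show "std_left w @ std_right w = w" "std_left w \<noteq> []" "std_right w \<noteq> []" by auto
qed

lemma std_length:
  assumes "2 \<le> length w"
  shows "length (std_left w) < length w" "length (std_right w) < length w"
    "length (std_left w) + length (std_right w) = length w"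
proof -
  have "length (std_left w) + length (std_right w) = length w"
    using arg_cong[OF std_append(1)[OF assms], of length] by simp
  moreover have "length (std_left w) > 0" "length (std_right w) > 0"
    using std_append[OF assms] by simp_all
  ultimately show "length (std_left w) < length w" "length (std_right w) < length w"
    "length (std_left w) + length (std_right w) = length w" by linarith+
qed

lemma proper_suffixes_trans:
  "v \<in> proper_suffixes w \<Longrightarrow> x \<in> proper_suffixes v \<Longrightarrow> x \<in> proper_suffixes w"
  unfolding proper_suffixes_def by fastforce

lemma proper_suffixes_length: "v \<in> proper_suffixes w \<Longrightarrow> length v < length w"
  unfolding proper_suffixes_def by auto

text \<open>A proper suffix of the least suffix is again a proper suffix of \<open>w\<close>, so
  minimality compares the two, and their lengths differ.\<close>

lemma lyndon_std_right:
  assumes "2 \<le> length w"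
  shows "lyndon (std_right w)"
  unfolding lyndon_altdef
proof (intro conjI ballI)
  show "std_right w \<noteq> []" using std_append(3)[OF assms] .
  fix v assume v: "v \<in> proper_suffixes (std_right w)"
  then have "std_right w \<le> v" "v \<noteq> std_right w"
    using std_right_le proper_suffixes_trans[OF std_right_in[OF assms]]
      proper_suffixes_length by blast+
  then show "std_right w < v" by simp
qed

text \<open>Write \<open>w = u @ v\<close> and suppose that a proper suffix \<open>b\<close> of
  \<open>u\<close> is below \<open>u\<close>. As \<open>w\<close> is Lyndon,
  \<open>u @ v < b @ v\<close>. If \<open>u = b @ c\<close>, cancelling \<open>b\<close> makes
  \<open>c @ v\<close> a suffix below the least one; otherwise \<open>b < u\<close> is decided
  inside the two words and contradicts this inequality.\<close>

lemma lyndon_std_left: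
  assumes "2 \<le> length w" "lyndon w"
  shows "lyndon (std_left w)"
  unfolding lyndon_altdef
proof (intro conjI ballI)
  let ?u = "std_left w" and ?v = "std_right w"
  have w: "w = ?u @ ?v" using std_append(1)[OF assms(1)] by simp
  show "?u \<noteq> []" using std_append(2)[OF assms(1)] .
  fix b assume b: "b \<in> proper_suffixes ?u"
  then obtain a where a: "a \<noteq> []" "?u = a @ b" "b \<noteq> []" by (auto simp: proper_suffixes_def)
  have "b @ ?v \<in> proper_suffixes w"
    unfolding proper_suffixes_def using a w by (metis (mono_tags, lifting) append_assoc append_is_Nil_conv mem_Collect_eq)
  then have less: "?u @ ?v < b @ ?v" using assms(2) w by (simp add: lyndon_altdef)
  show "?u < b"
  proof (rule ccontr)
    assume "\<not> ?u < b"
    moreover have "b \<noteq> ?u" using proper_suffixes_length[OF b] by auto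
    ultimately have bu: "b < ?u" by simp
    show False
    proof (cases "\<exists>c. ?u = b @ c")
      case True
      then obtain c where c: "?u = b @ c" by blast
      then have "c \<noteq> []" using bu by auto
      have "c @ ?v < ?v" using less c by (simp add: lex_append_cancel)
      moreover have "c @ ?v \<in> proper_suffixes w"
        unfolding proper_suffixes_def using \<open>c \<noteq> []\<close> c w a(3)
        by (metis (mono_tags, lifting) append_assoc append_is_Nil_conv mem_Collect_eq)
      ultimately show False using std_right_le by fastforce
    next
      case False
      then have "b @ ?v < ?u @ ?v" using lex_append_mono[OF bu] by blast
      then show False using less by simp
    qed
  qed
qed

lemma std_less:
  assumes "2 \<le> length w" "lyndon w"
  shows "std_left w < std_right w"
proof -
  have "std_left w < w" using lex_less_append std_append[OF assms(1)] by metis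
  also have "w < std_right w"
    using assms(2) std_right_in[OF assms(1)] by (simp add: lyndon_altdef)
  finally show ?thesis .
qed

text \<open>The delicate case is \<open>v = u @ c\<close>: there \<open>v < c\<close> because
  \<open>v\<close> is Lyndon, and prefixing \<open>u\<close> on both sides gives the claim.\<close>

lemma lyndon_append_less:
  assumes "lyndon u" "lyndon v" "u < v"
  shows "u @ v < v"
proof (cases "\<exists>c. v = u @ c")
  case True
  then obtain c where c: "v = u @ c" by blast
  then have "c \<noteq> []" using assms(3) by auto
  then have "v < c" using assms(1,2) c unfolding lyndon_def by blast
  then show ?thesis using c by (metis lex_append_cancel)
next
  case False
  then show ?thesis using lex_append_mono[OF assms(3), of v "[]"] by auto
qed

lemma proper_suffixes_append:
  assumes "x \<in> proper_suffixes (u @ v)"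
  obtains "x \<in> proper_suffixes v" | "x = v" | b where "b \<in> proper_suffixes u" "x = b @ v"
proof -
  from assms obtain a where a: "x \<noteq> []" "a \<noteq> []" "u @ v = a @ x"
    by (auto simp: proper_suffixes_def)
  from a(3) obtain us where "u = a @ us \<and> us @ v = x \<or> u @ us = a \<and> v = us @ x"
    by (auto simp: append_eq_append_conv2)
  then show thesis
    using a that unfolding proper_suffixes_def by (cases "us = []") auto
qed

lemma lyndon_append:
  assumes "lyndon u" "lyndon v" "u < v"
  shows "lyndon (u @ v)"
  unfolding lyndon_altdef
proof (intro conjI ballI)
  show "u @ v \<noteq> []" using assms by (auto simp: lyndon_def)
  fix x assume "x \<in> proper_suffixes (u @ v)"
  then show "u @ v < x"
  proof (cases rule: proper_suffixes_append)
    case 1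
    then have "v < x" using assms(2) by (simp add: lyndon_altdef)
    then show ?thesis using lyndon_append_less[OF assms] by simp
  next
    case 2
    then show ?thesis using lyndon_append_less[OF assms] by simp
  next
    case (3 b)
    then have "u < b" "length b \<le> length u"
      using assms(1) proper_suffixes_length[of b u] by (auto simp: lyndon_altdef)
    then show ?thesis using lex_append_mono_length 3 by blast
  qed
qed

text \<open>A proper suffix of \<open>u @ v\<close> longer than \<open>v\<close> is
  \<open>b @ v\<close> with \<open>b\<close> a proper suffix of \<open>u\<close>, so the last
  hypothesis is what keeps \<open>v\<close> minimal. Its failure is the case in which a commutator
  of two brackets has to be rewritten.\<close>

lemma std_append_eq:
  assumes "lyndon u" "lyndon v" "u < v" "length u \<ge> 2 \<Longrightarrow> v \<le> std_right u"
  shows "std_right (u @ v) = v" "std_left (u @ v) = u"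
proof -
  have "v \<in> proper_suffixes (u @ v)"
    using assms(1,2) by (auto simp: proper_suffixes_def lyndon_def)
  moreover have "v \<le> x" if "x \<in> proper_suffixes (u @ v)" for x
    using that
  proof (cases rule: proper_suffixes_append)
    case 1
    then show ?thesis using assms(2) by (simp add: lyndon_altdef less_imp_le)
  next
    case (3 b)
    then have "length b < length u" "b \<noteq> []"
      using proper_suffixes_length[of b u] by (auto simp: proper_suffixes_def)
    then have "length u \<ge> 2" by (cases b) auto
    then have "v \<le> b" using assms(4) std_right_le[OF 3(1)] by auto
    also have "b \<le> b @ v" using lex_less_append[of v b] by (cases "v = []") auto
    finally show ?thesis using 3 by simp
  qed simp
  ultimately show "std_right (u @ v) = v"
    unfolding std_right_def by (intro Min_eqI finite_proper_suffixes) auto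
  then show "std_left (u @ v) = u" unfolding std_left_def by simp
qed

text \<open>Divisibility of the exponents makes one word a power of the other, say
  \<open>u = v^k\<close>. If \<open>k >= 2\<close>, then \<open>u\<close> both starts and ends with
  \<open>v\<close>; the suffix gives \<open>u < v\<close> and the prefix \<open>v < u\<close>. In
  the application the exponents are powers of the same prime.\<close>

lemma lyndon_power_inj:
  assumes "lyndon u" "lyndon v" "concat (replicate i u) = concat (replicate j v)"
    "length u * i = length v * j" "i > 0" "j > 0" "i dvd j \<or> j dvd i"
  shows "u = v"
proof -
  have *: "u = v" if uv: "lyndon u" "concat (replicate i u) = concat (replicate j v)"
    "length u * i = length v * j" "i > 0" "j > 0" "i dvd j" for u v :: "'a list" and i j
  proof -
    obtain k where k: "j = i * k" using uv(6) by (elim dvdE)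
    have len: "length u = length v * k" using uv(3,4) k by (simp add: ac_simps)
    have u: "u = concat (replicate k v)"
    proof -
      have "j = k + (j - k)" using k uv(4) by (cases i) auto
      then have "concat (replicate j v) = concat (replicate k v) @ concat (replicate (j - k) v)"
        by (metis concat_append replicate_add)
      moreover obtain i' where "i = Suc i'" using uv(4) by (cases i) auto
      moreover have "length (concat (replicate k v)) = length u"
        using len by (simp add: length_concat sum_list_replicate)
      ultimately show ?thesis using uv(2) by auto
    qed
    have "k \<noteq> 0" using uv(5) k by auto
    then obtain k' where k': "k = Suc k'" by (cases k) auto
    show "u = v"
    proof (cases k')
      case (Suc k'')
      have comm: "v @ concat (replicate n v) = concat (replicate n v) @ v" for n
        by (induction n) auto
      have "v \<noteq> []" using uv(1) u by (auto simp: lyndon_def)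
      moreover have uv': "u = v @ (v @ concat (replicate k'' v))" using u k' Suc by simp
      moreover have "u = (v @ concat (replicate k'' v)) @ v" using uv' comm by simp
      ultimately have "u < v"
        using uv(1) unfolding lyndon_def by blast
      moreover have "v < u" using \<open>v \<noteq> []\<close> by (subst uv') (simp add: lex_less_append)
      ultimately have False by simp
      then show ?thesis by simp
    qed (use u k' in simp)
  qed
  show ?thesis using assms *[of u i j v] *[of v j i u] by metis
qed

section \<open>Noncommutative power series\<close>

text \<open>The Cauchy product over all splittings of a word. Recursion on the word, shifting the
  left series past the letter just read, turns the ring laws into short inductions; the sum form
  follows in \<open>convolution_sum\<close>.\<close>

primrec convolution :: "('a list \<Rightarrow> int) \<Rightarrow> ('a list \<Rightarrow> int) \<Rightarrow> 'a list \<Rightarrow> int" where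
  "convolution f g [] = f [] * g []"
| "convolution f g (x # w) = f [] * g (x # w) + convolution (\<lambda>v. f (x # v)) g w"

lemma convolution_add_left: "convolution (\<lambda>v. f v + g v) h w = convolution f h w + convolution g h w"
  by (induction w arbitrary: f g) (simp_all add: algebra_simps)

lemma convolution_add_right: "convolution f (\<lambda>v. g v + h v) w = convolution f g w + convolution f h w"
  by (induction w arbitrary: f) (simp_all add: algebra_simps)

lemma convolution_scale_left: "convolution (\<lambda>v. c * f v) h w = c * convolution f h w"
  by (induction w arbitrary: f) (simp_all add: algebra_simps)

lemma convolution_assoc: "convolution (convolution f g) h w = convolution f (convolution g h) w"
  by (induction w arbitrary: f g)
    (simp_all add: convolution_add_left convolution_scale_left algebra_simps)

lemma convolution_sum: "convolution f g w = (\<Sum>i\<le>length w. f (take i w) * g (drop i w))"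
  by (induction w arbitrary: f) (simp_all add: sum.atMost_Suc_shift del: sum.atMost_Suc)

lemma convolution_zero_left: "convolution (\<lambda>_. 0) g w = 0"
  by (simp add: convolution_sum)

lemma convolution_one_left: "convolution (\<lambda>w. if w = [] then 1 else 0) g w = g w"
  by (cases w) (simp_all add: convolution_zero_left)

lemma convolution_one_right: "convolution f (\<lambda>w. if w = [] then 1 else 0) w = f w"
  by (induction w arbitrary: f) simp_all

text \<open>The infinite alphabet lets one ring serve free groups of every rank, and also provides
  the word \<open>[0..<m]\<close> with distinct letters through which matrices are lifted.\<close>

typedef ncps = "UNIV :: (nat list \<Rightarrow> int) set" morphisms nc_coeff Abs_ncps ..

setup_lifting type_definition_ncps

instantiation ncps :: ring_1
begin

lift_definition zero_ncps :: ncps is "\<lambda>_. 0" .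
lift_definition one_ncps :: ncps is "\<lambda>w. if w = [] then 1 else 0" .
lift_definition plus_ncps :: "ncps \<Rightarrow> ncps \<Rightarrow> ncps" is "\<lambda>f g w. f w + g w" .
lift_definition minus_ncps :: "ncps \<Rightarrow> ncps \<Rightarrow> ncps" is "\<lambda>f g w. f w - g w" .
lift_definition uminus_ncps :: "ncps \<Rightarrow> ncps" is "\<lambda>f w. - f w" .
lift_definition times_ncps :: "ncps \<Rightarrow> ncps \<Rightarrow> ncps" is convolution .

instance
proof
  fix a b c :: ncps
  show "a * b * c = a * (b * c)"
    by transfer (auto simp: convolution_assoc)
  show "1 * a = a" "a * 1 = a"
    by (transfer; auto simp: convolution_one_left convolution_one_right)+
  show "(a + b) * c = a * c + b * c" "a * (b + c) = a * b + a * c"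
    by (transfer; auto simp: convolution_add_left convolution_add_right)+
  show "(0 :: ncps) \<noteq> 1"
    by transfer (auto simp: fun_eq_iff)
qed (transfer; auto simp: algebra_simps)+

end

lemma ncps_eqI: "(\<And>w. nc_coeff f w = nc_coeff g w) \<Longrightarrow> f = g"
  by transfer auto

lemma nc_coeff_simps [simp]:
  "nc_coeff 0 w = 0"
  "nc_coeff 1 w = (if w = [] then 1 else 0)"
  "nc_coeff (f + g) w = nc_coeff f w + nc_coeff g w"
  "nc_coeff (f - g) w = nc_coeff f w - nc_coeff g w"
  "nc_coeff (- f) w = - nc_coeff f w"
  by (transfer; simp)+

lemma nc_coeff_mult:
  "nc_coeff (f * g) w = (\<Sum>i\<le>length w. nc_coeff f (take i w) * nc_coeff g (drop i w))"
  by transfer (rule convolution_sum)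

lemma nc_coeff_mult_Nil [simp]: "nc_coeff (f * g) [] = nc_coeff f [] * nc_coeff g []"
  by (simp add: nc_coeff_mult)

lemma nc_coeff_of_nat_mult [simp]: "nc_coeff (of_nat n * f) w = int n * nc_coeff f w"
  by (induction n) (simp_all add: algebra_simps)

lemma nc_coeff_sum: "nc_coeff (\<Sum>i\<in>A. f i) w = (\<Sum>i\<in>A. nc_coeff (f i) w)"
  by (induction A rule: infinite_finite_induct) auto

lemma one_plus_power:
  "(1 + f :: 'r :: ring_1) ^ n = (\<Sum>k\<le>n. of_nat (n choose k) * f ^ k)"
proof (induction n)
  case (Suc n)
  have "(\<Sum>k\<le>Suc n. of_nat (Suc n choose k) * f ^ k)
      = 1 + (\<Sum>k\<le>n. of_nat (n choose Suc k) * f ^ Suc k) + (\<Sum>k\<le>n. of_nat (n choose k) * f ^ Suc k)"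
    by (subst sum.atMost_Suc_shift) (simp add: sum.distrib algebra_simps)
  also have "1 + (\<Sum>k\<le>n. of_nat (n choose Suc k) * f ^ Suc k)
      = (\<Sum>k\<le>Suc n. of_nat (n choose k) * f ^ k)"
    by (subst sum.atMost_Suc_shift) simp
  also have "\<dots> = (\<Sum>k\<le>n. of_nat (n choose k) * f ^ k)"
    by (simp add: binomial_eq_0)
  also have "(\<Sum>k\<le>n. of_nat (n choose k) * f ^ Suc k) = (\<Sum>k\<le>n. of_nat (n choose k) * f ^ k) * f"
    by (simp add: sum_distrib_right power_commutes mult.assoc)
  finally show ?case by (simp add: Suc power_Suc2 distrib_left del: power_Suc sum.atMost_Suc)
qed simp

text \<open>The mixed binomials are divisible by \<open>p\<close>. One factor \<open>f\<close> is
  kept in front of the remainder, so that the remainder lies in every ideal that contains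
  \<open>f\<close>.\<close>

lemma one_plus_power_prime:
  assumes "Factorial_Ring.prime (p :: nat)"
  shows "\<exists>h. (1 + f :: 'r :: ring_1) ^ p = 1 + f ^ p + of_nat p * (f * h)"
proof -
  have p: "p = Suc (p - 1)" using prime_gt_0_nat[OF assms] by simp
  have "(\<Sum>k\<in>{1..<p}. of_nat (p choose k) * f ^ k)
      = (\<Sum>k\<in>{1..<p}. of_nat p * (f * (of_nat ((p choose k) div p) * f ^ (k - 1))))"
  proof (rule sum.cong)
    fix k assume k: "k \<in> {1..<p}"
    have "p dvd (p choose k)"
      using k assms by (intro dvd_choose_prime) auto
    then have "(of_nat (p choose k) :: 'r) = of_nat p * of_nat ((p choose k) div p)"
      by (metis dvd_mult_div_cancel of_nat_mult)
    moreover have "f ^ k = f * f ^ (k - 1)" using k by (cases k) auto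
    moreover have "of_nat m * f = f * of_nat m" for m
      by (rule mult_of_nat_commute)
    ultimately show "of_nat (p choose k) * f ^ k
        = of_nat p * (f * (of_nat ((p choose k) div p) * f ^ (k - 1)))"
      by (metis mult.assoc)
  qed simp
  also have "\<dots> = of_nat p * (f * (\<Sum>k\<in>{1..<p}. of_nat ((p choose k) div p) * f ^ (k - 1)))"
    by (simp add: sum_distrib_left)
  finally have *: "(\<Sum>k\<in>{1..<p}. of_nat (p choose k) * f ^ k) = \<dots>" .
  have "{..p} = insert 0 (insert p {1..<p})" using prime_gt_0_nat[OF assms] by auto
  then have "(1 + f) ^ p = 1 + (f ^ p + (\<Sum>k\<in>{1..<p}. of_nat (p choose k) * f ^ k))"
    using prime_gt_0_nat[OF assms] by (simp add: one_plus_power)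
  then show ?thesis unfolding * by (metis add.assoc)
qed

section \<open>The group of series with constant term 1\<close>

definition nc_units :: "ncps monoid" where
  "nc_units = \<lparr>carrier = {f. nc_coeff f [] = 1}, monoid.mult = (*), one = 1\<rparr>"

lemma nc_units_simps [simp]:
  "f \<in> carrier nc_units \<longleftrightarrow> nc_coeff f [] = 1"
  "f \<otimes>\<^bsub>nc_units\<^esub> g = f * g"
  "\<one>\<^bsub>nc_units\<^esub> = 1"
  by (simp_all add: nc_units_def)

text \<open>The equation \<open>f * h = 1\<close> at the word \<open>w\<close>, solved for the
  coefficient of \<open>h\<close> at \<open>w\<close>; this is possible because the constant term of
  \<open>f\<close> is 1.\<close>

function nc_inverse_coeff :: "(nat list \<Rightarrow> int) \<Rightarrow> nat list \<Rightarrow> int" where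
  "nc_inverse_coeff f w = (if w = [] then 1
     else - (\<Sum>i\<in>{1..length w}. f (take i w) * nc_inverse_coeff f (drop i w)))"
  by pat_completeness auto
termination by (relation "measure (\<lambda>(f, w). length w)") auto

declare nc_inverse_coeff.simps [simp del]

lemma nc_right_inverse:
  assumes "nc_coeff f [] = 1"
  shows "\<exists>h. nc_coeff h [] = 1 \<and> f * h = 1"
proof (intro exI conjI)
  let ?h = "Abs_ncps (nc_inverse_coeff (nc_coeff f))"
  have h: "nc_coeff ?h w = nc_inverse_coeff (nc_coeff f) w" for w
    by (simp add: Abs_ncps_inverse)
  show "nc_coeff ?h [] = 1" by (simp add: h nc_inverse_coeff.simps)
  show "f * ?h = 1"
  proof (rule ncps_eqI)
    fix w
    show "nc_coeff (f * ?h) w = nc_coeff 1 w"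
    proof (cases "w = []")
      case True
      then show ?thesis using assms by (simp add: h nc_inverse_coeff.simps[of _ "[]"])
    next
      case False
      have *: "{..length w} = insert 0 {1..length w}" by auto
      have "nc_coeff (f * ?h) w = nc_inverse_coeff (nc_coeff f) w
          + (\<Sum>i\<in>{1..length w}. nc_coeff f (take i w) * nc_inverse_coeff (nc_coeff f) (drop i w))"
        unfolding nc_coeff_mult h * by (simp add: assms)
      also have "\<dots> = 0" using False by (subst nc_inverse_coeff.simps) simp
      finally show ?thesis using False by simp
    qed
  qed
qed

lemma group_nc_units: "group nc_units"
proof (rule groupI)
  fix f assume "f \<in> carrier nc_units"
  then obtain h where h: "nc_coeff h [] = 1" "f * h = 1" using nc_right_inverse by auto
  then obtain k where k: "nc_coeff k [] = 1" "h * k = 1" using nc_right_inverse by auto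
  \<comment> \<open>A right inverse has a right inverse in turn, and associativity identifies the
    latter with \<open>f\<close>; hence one-sided inverses suffice.\<close>
  have "f = k" using h k by (metis mult.assoc mult.left_neutral mult.right_neutral)
  then show "\<exists>y\<in>carrier nc_units. y \<otimes>\<^bsub>nc_units\<^esub> f = \<one>\<^bsub>nc_units\<^esub>"
    using h k by auto
qed (simp_all add: mult.assoc)

interpretation ncu: group nc_units by (rule group_nc_units)

lemma nc_units_inv:
  assumes "nc_coeff f [] = 1"
  shows "nc_coeff (inv\<^bsub>nc_units\<^esub> f) [] = 1" "f * inv\<^bsub>nc_units\<^esub> f = 1" "inv\<^bsub>nc_units\<^esub> f * f = 1"
  using ncu.inv_closed[of f] ncu.r_inv[of f] ncu.l_inv[of f] assms by auto

lemma nc_units_pow [simp]: "f [^]\<^bsub>nc_units\<^esub> (n :: nat) = f ^ n"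
  by (induction n) (simp_all add: power_commutes)

section \<open>Multiplicative filtrations by divisibility of coefficients\<close>

text \<open>\<open>d i a\<close> is the divisor that step \<open>i\<close> of the filtration requires of the coefficients at words of
  length \<open>a\<close>.\<close>

locale nc_filtration =
  fixes d :: "nat \<Rightarrow> nat \<Rightarrow> int"
  assumes d_0 [simp]: "d 0 a = 1"
    and d_1: "d 1 (Suc a) = 1"
    and d_mult: "d (i + j) (a + b) dvd d i a * d j b"
    and d_mono: "i \<le> j \<Longrightarrow> d i a dvd d j a"
begin

definition filt :: "nat \<Rightarrow> ncps set" where
  "filt i = {f. \<forall>u. d i (length u) dvd nc_coeff f u}"

lemma filt_0 [simp]: "f \<in> filt 0" by (simp add: filt_def)

lemma filt_zero [simp]: "0 \<in> filt i" by (simp add: filt_def)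

lemma filt_add: "f \<in> filt i \<Longrightarrow> g \<in> filt i \<Longrightarrow> f + g \<in> filt i"
  by (simp add: filt_def)

lemma filt_diff: "f \<in> filt i \<Longrightarrow> g \<in> filt i \<Longrightarrow> f - g \<in> filt i"
  by (simp add: filt_def)

lemma filt_uminus: "f \<in> filt i \<Longrightarrow> - f \<in> filt i"
  by (simp add: filt_def)

lemma filt_mono: "f \<in> filt j \<Longrightarrow> i \<le> j \<Longrightarrow> f \<in> filt i"
  unfolding filt_def using d_mono dvd_trans by blast

lemma filt_mult: "f \<in> filt i \<Longrightarrow> g \<in> filt j \<Longrightarrow> f * g \<in> filt (i + j)"
  unfolding filt_def
proof (intro CollectI allI)
  fix u :: "nat list"
  assume f: "f \<in> {f. \<forall>u. d i (length u) dvd nc_coeff f u}"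
    and g: "g \<in> {f. \<forall>u. d j (length u) dvd nc_coeff f u}"
  show "d (i + j) (length u) dvd nc_coeff (f * g) u"
    unfolding nc_coeff_mult
  proof (rule dvd_sum)
    fix k assume "k \<in> {..length u}"
    then have "d (i + j) (length u) dvd d i (length (take k u)) * d j (length (drop k u))"
      using d_mult[of i j "length (take k u)" "length (drop k u)"] by simp
    also have "\<dots> dvd nc_coeff f (take k u) * nc_coeff g (drop k u)"
      using f g by (intro mult_dvd_mono) (auto simp del: length_take length_drop)
    finally show "d (i + j) (length u) dvd nc_coeff f (take k u) * nc_coeff g (drop k u)" .
  qed
qed

text \<open>Step 0 is the whole ring, so multiplicativity already makes every step a two-sided
  ideal.\<close>

lemma filt_mult_left: "f \<in> filt i \<Longrightarrow> g * f \<in> filt i"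
  using filt_mult[of g 0 f i] by simp

lemma filt_mult_right: "f \<in> filt i \<Longrightarrow> f * g \<in> filt i"
  using filt_mult[of f i g 0] by simp

lemma filt_power: "f \<in> filt i \<Longrightarrow> f ^ n \<in> filt (n * i)"
  by (induction n) (auto intro: filt_mult)

definition one_units :: "nat \<Rightarrow> ncps set" where
  "one_units i = {f \<in> carrier nc_units. f - 1 \<in> filt i}"

lemma one_units_mono: "f \<in> one_units j \<Longrightarrow> i \<le> j \<Longrightarrow> f \<in> one_units i"
  unfolding one_units_def using filt_mono by blast

lemma subgroup_one_units: "subgroup (one_units i) nc_units"
proof (rule ncu.subgroupI)
  show "one_units i \<noteq> {}" unfolding one_units_def by (auto intro!: exI[of _ 1])
  fix f assume f: "f \<in> one_units i"
  show "inv\<^bsub>nc_units\<^esub> f \<in> one_units i"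
  proof -
    have "inv\<^bsub>nc_units\<^esub> f - 1 = - ((f - 1) * inv\<^bsub>nc_units\<^esub> f)"
      using f by (simp add: one_units_def algebra_simps nc_units_inv)
    then show ?thesis using f nc_units_inv(1)[of f] unfolding one_units_def
      by (simp del: minus_mult_left mult_minus_left add: filt_uminus filt_mult_right)
  qed
  fix g assume g: "g \<in> one_units i"
  have eq: "f * g - 1 = (f - 1) * g + (g - 1)" by (simp add: algebra_simps)
  have "(f - 1) * g + (g - 1) \<in> filt i"
    using f g by (intro filt_add filt_mult_right) (auto simp: one_units_def)
  then have "f * g - 1 \<in> filt i" unfolding eq .
  then show "f \<otimes>\<^bsub>nc_units\<^esub> g \<in> one_units i"
    using f g by (simp add: one_units_def)
qed (auto simp: one_units_def)

text \<open>A group commutator minus 1 is a unit times the ring commutator \<open>f g - g f\<close>,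
  which does not change when 1 is subtracted from both \<open>f\<close> and \<open>g\<close>; then
  it is a difference of products of elements of steps \<open>i\<close> and \<open>j\<close>.\<close>

lemma one_units_commutator:
  assumes "f \<in> one_units i" "g \<in> one_units j"
  shows "inv\<^bsub>nc_units\<^esub> f * inv\<^bsub>nc_units\<^esub> g * f * g \<in> one_units (i + j)"
proof -
  let ?f = "inv\<^bsub>nc_units\<^esub> f" and ?g = "inv\<^bsub>nc_units\<^esub> g"
  have fg: "nc_coeff f [] = 1" "nc_coeff g [] = 1" using assms by (auto simp: one_units_def)
  have "?f * ?g * (g * f) = ?f * (?g * g) * f" by (simp only: mult.assoc)
  then have "?f * ?g * (g * f) = 1" using nc_units_inv[OF fg(1)] nc_units_inv[OF fg(2)] by simp
  then have "?f * ?g * f * g - 1 = ?f * ?g * ((f - 1) * (g - 1) - (g - 1) * (f - 1))"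
    by (simp add: algebra_simps)
  moreover have "(f - 1) * (g - 1) \<in> filt (i + j)" "(g - 1) * (f - 1) \<in> filt (i + j)"
    using assms filt_mult[of "f - 1" i "g - 1" j] filt_mult[of "g - 1" j "f - 1" i]
    by (auto simp: one_units_def add.commute)
  ultimately have "?f * ?g * f * g - 1 \<in> filt (i + j)"
    by (simp add: filt_mult_left filt_diff)
  then show ?thesis using fg nc_units_inv(1) by (simp add: one_units_def)
qed

end

section \<open>Leading terms in the length-lexicographic order\<close>

definition sl_less :: "'a :: linorder list \<Rightarrow> 'a list \<Rightarrow> bool" where
  "sl_less u v \<longleftrightarrow> length u < length v \<or> length u = length v \<and> u < v"

lemma sl_linear: "sl_less u v \<or> u = v \<or> sl_less v u"
  unfolding sl_less_def by (metis linorder_less_linear)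

lemma sl_less_trans: "sl_less u v \<Longrightarrow> sl_less v w \<Longrightarrow> sl_less u w"
  unfolding sl_less_def by auto

text \<open>Length comes first in this order, so all lengths must agree, and on words of equal
  length the lexicographic order is compatible with concatenation on both sides. The plain
  lexicographic order is not compatible on the right.\<close>

lemma sl_append_cases:
  assumes "\<not> sl_less (w @ v) (y @ z)" "\<not> sl_less y w" "\<not> sl_less z v"
  shows "y = w \<and> z = v"
proof -
  have len: "length y = length w" "length z = length v"
    using assms unfolding sl_less_def by auto
  then have *: "w \<le> y" "v \<le> z" "y @ z \<le> w @ v"
    using assms unfolding sl_less_def by auto
  have "\<not> w < y"
  proof
    assume "w < y"
    then have "w @ v < y @ z" using lex_append_mono_length[of w y v z] len by simp
    then show False using *(3) by simp
  qed
  then have "y = w" using *(1) by order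
  then show ?thesis using * lex_append_cancel[of w v z] by (metis leD le_neq_trans)
qed

text \<open>Modulo \<open>q\<close>, the leading term of \<open>f\<close> in the length-lexicographic order is \<open>c w\<close>. For \<open>q = 0\<close> this
  is meant exactly.\<close>

definition leads :: "int \<Rightarrow> ncps \<Rightarrow> nat list \<Rightarrow> int \<Rightarrow> bool" where
  "leads q f w c \<longleftrightarrow> q dvd nc_coeff f w - c \<and> (\<forall>x. sl_less x w \<longrightarrow> q dvd nc_coeff f x)"

text \<open>Among the splittings of words up to \<open>w @ v\<close>, only the one into
  \<open>w\<close> and \<open>v\<close> avoids a part below its leading word; every other summand of
  the Cauchy product is divisible by \<open>q\<close>.\<close>

lemma leads_mult:
  assumes "leads q f w c" "leads q g v c'"
  shows "leads q (f * g) (w @ v) (c * c')"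
proof -
  have term_dvd: "q dvd nc_coeff f y * nc_coeff g z"
    if "\<not> sl_less (w @ v) (y @ z)" "y \<noteq> w \<or> z \<noteq> v" for y z
  proof -
    have "sl_less y w \<or> sl_less z v" using sl_append_cases[OF that(1)] that(2) by blast
    then show ?thesis using assms unfolding leads_def by auto
  qed
  have "q dvd nc_coeff (f * g) x" if "sl_less x (w @ v)" for x
    unfolding nc_coeff_mult
  proof (rule dvd_sum)
    fix i
    have irrefl: "\<not> sl_less (w @ v) (w @ v)" by (simp add: sl_less_def)
    have "\<not> sl_less (w @ v) (take i x @ drop i x)"
      unfolding append_take_drop_id using that irrefl sl_less_trans by blast
    moreover have "take i x \<noteq> w \<or> drop i x \<noteq> v"
      using that irrefl append_take_drop_id[of i x] by metis
    ultimately show "q dvd nc_coeff f (take i x) * nc_coeff g (drop i x)" by (rule term_dvd)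
  qed
  moreover have "q dvd nc_coeff (f * g) (w @ v) - c * c'"
  proof -
    let ?r = "\<Sum>i\<in>{..length (w @ v)} - {length w}.
      nc_coeff f (take i (w @ v)) * nc_coeff g (drop i (w @ v))"
    have "nc_coeff (f * g) (w @ v) = nc_coeff f w * nc_coeff g v + ?r"
      unfolding nc_coeff_mult by (subst sum.remove[of _ "length w"]) simp_all
    then have eq: "nc_coeff (f * g) (w @ v) - c * c'
        = (nc_coeff f w - c) * nc_coeff g v + c * (nc_coeff g v - c') + ?r"
      by (simp add: algebra_simps)
    have "q dvd ?r"
    proof (rule dvd_sum)
      fix i assume i: "i \<in> {..length (w @ v)} - {length w}"
      then have "length (take i (w @ v)) \<noteq> length w" by auto
      then have "take i (w @ v) \<noteq> w" by metis
      moreover have "\<not> sl_less (w @ v) (take i (w @ v) @ drop i (w @ v))"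
        by (simp only: append_take_drop_id) (simp add: sl_less_def)
      ultimately show "q dvd nc_coeff f (take i (w @ v)) * nc_coeff g (drop i (w @ v))"
        using term_dvd by blast
    qed
    then show ?thesis
      unfolding eq using assms by (intro dvd_add dvd_mult dvd_mult2) (auto simp: leads_def)
  qed
  ultimately show ?thesis unfolding leads_def by blast
qed

lemma leads_one: "leads q 1 [] 1"
  by (simp add: leads_def sl_less_def)

lemma leads_Nil: "leads q f [] (nc_coeff f [])"
  by (simp add: leads_def sl_less_def)

lemma leads_power: "leads q f w c \<Longrightarrow> leads q (f ^ n) (concat (replicate n w)) (c ^ n)"
  by (induction n) (auto simp: leads_one intro!: leads_mult)

lemma leads_add: "leads q f w c \<Longrightarrow> leads q g w c' \<Longrightarrow> leads q (f + g) w (c + c')"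
  unfolding leads_def using dvd_add[of q "nc_coeff f w - c" "nc_coeff g w - c'"] by (simp add: algebra_simps)

lemma leads_uminus: "leads q f w c \<Longrightarrow> leads q (- f) w (- c)"
  unfolding leads_def using dvd_minus_iff[of q "nc_coeff f w - c"] by simp

lemma leads_higher: "leads q f v c \<Longrightarrow> sl_less w v \<Longrightarrow> leads q f w 0"
  by (simp add: leads_def) (blast intro: sl_less_trans)

lemma leads_add_higher:
  assumes "leads q f w c" "leads q g v c'" "sl_less w v"
  shows "leads q (f + g) w c"
  using leads_add[OF assms(1) leads_higher[OF assms(2,3)]] by simp

lemma leads_cong:
  assumes "leads q f w c" "\<And>x. q dvd nc_coeff g x - nc_coeff f x"
  shows "leads q g w c"
proof -
  have "leads q (g - f) w 0" using assms(2) by (simp add: leads_def)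
  then show ?thesis using leads_add[OF assms(1)] by fastforce
qed

lemma sl_less_append: "w \<noteq> [] \<Longrightarrow> sl_less v (w @ v)" "w \<noteq> [] \<Longrightarrow> sl_less v (v @ w)"
  by (simp_all add: sl_less_def)

text \<open>The cross term \<open>(f - 1) * (g - 1)\<close> leads at \<open>w @ w\<close>, which is
  longer than \<open>w\<close>, so leading coefficients add.\<close>

lemma leads_units_mult:
  assumes "leads q (f - 1) w c" "leads q (g - 1) w c'" "w \<noteq> []"
  shows "leads q (f * g - 1) w (c + c')"
proof -
  have eq: "f * g - 1 = ((f - 1) + (g - 1)) + (f - 1) * (g - 1)" by (simp add: algebra_simps)
  show ?thesis
    unfolding eq
    by (rule leads_add_higher[OF leads_add[OF assms(1,2)] leads_mult[OF assms(1,2)]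
          sl_less_append(1)[OF assms(3)]])
qed

lemma leads_units_inv:
  assumes "leads q (f - 1) w c" "f \<in> carrier nc_units" "w \<noteq> []"
  shows "leads q (inv\<^bsub>nc_units\<^esub> f - 1) w (- c)"
proof -
  have "inv\<^bsub>nc_units\<^esub> f - 1 = - ((f - 1) * inv\<^bsub>nc_units\<^esub> f)"
    using assms(2) by (simp add: algebra_simps nc_units_inv)
  moreover have "leads q ((f - 1) * inv\<^bsub>nc_units\<^esub> f) w c"
    using leads_mult[OF assms(1) leads_Nil[of q "inv\<^bsub>nc_units\<^esub> f"]] nc_units_inv(1)[of f] assms(2)
    by simp
  ultimately show ?thesis using leads_uminus by metis
qed

lemma leads_units_pow:
  assumes "leads q (f - 1) w c" "w \<noteq> []"
  shows "leads q (f ^ n - 1) w (int n * c)"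
proof (induction n)
  case 0
  then show ?case by (simp add: leads_def)
next
  case (Suc n)
  have eq: "int (Suc n) * c = c + int n * c" by (simp add: algebra_simps)
  show ?case unfolding eq power_Suc by (rule leads_units_mult[OF assms(1) Suc assms(2)])
qed

lemma leads_units_int_pow:
  assumes "leads q (f - 1) w c" "f \<in> carrier nc_units" "w \<noteq> []"
  shows "leads q (f [^]\<^bsub>nc_units\<^esub> (e :: int) - 1) w (e * c)"
proof (cases "e \<ge> 0")
  case True
  then obtain n where n: "e = int n" using nonneg_eq_int by blast
  have "f [^]\<^bsub>nc_units\<^esub> e = f ^ n" unfolding n int_pow_int by simp
  then show ?thesis using leads_units_pow[OF assms(1,3), of n] n by simp
next
  case False
  then obtain n where n: "e = - int n" using that[of "nat (- e)"] by simp
  have "f ^ n \<in> carrier nc_units" using ncu.nat_pow_closed[OF assms(2), of n] by simp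
  moreover have "f [^]\<^bsub>nc_units\<^esub> e = inv\<^bsub>nc_units\<^esub> (f ^ n)"
    unfolding n using ncu.int_pow_neg_int[OF assms(2), of n] by simp
  ultimately show ?thesis
    using leads_units_inv[OF leads_units_pow[OF assms(1,3), of n] _ assms(3)] n by simp
qed

text \<open>Modulo \<open>p\<close> the \<open>p\<close>-th power acts on \<open>f - 1\<close> as
  Frobenius. The coefficient at \<open>w\<close> would be multiplied by \<open>p\<close> and
  disappear; instead the leading word itself is repeated and keeps coefficient 1.\<close>

lemma leads_units_prime_pow:
  assumes "Factorial_Ring.prime (p :: nat)" "leads (int p) (f - 1) w 1"
  shows "leads (int p) (f ^ (p ^ j) - 1) (concat (replicate (p ^ j) w)) 1"
proof (induction j)
  case (Suc j)
  let ?g = "f ^ p ^ j - 1"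
  obtain h where h: "(1 + ?g) ^ p = 1 + ?g ^ p + of_nat p * (?g * h)"
    using one_plus_power_prime[OF assms(1)] by blast
  have "concat (replicate p (concat (replicate m w))) = concat (replicate (m * p) w)" for m
    by (induction p) (simp_all add: replicate_add)
  then have "leads (int p) (?g ^ p) (concat (replicate (p ^ Suc j) w)) 1"
    using leads_power[OF Suc, of p] by (simp add: mult.commute)
  moreover have "f ^ p ^ Suc j = (1 + ?g) ^ p" by (simp add: mult.commute flip: power_mult)
  then have "f ^ p ^ Suc j - 1 = ?g ^ p + of_nat p * (?g * h)" unfolding h by simp
  ultimately show ?case
    by (auto elim!: leads_cong)
qed (use assms in simp)

text \<open>The ring commutator of \<open>f - 1\<close> and \<open>g - 1\<close> has candidates
  \<open>u @ v\<close> and \<open>v @ u\<close>, and the hypothesis selects the first. The unit in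
  front has constant term 1 and leaves the leading term in place.\<close>

lemma leads_units_commutator:
  assumes "leads q (f - 1) u 1" "leads q (g - 1) v 1" "f \<in> carrier nc_units" "g \<in> carrier nc_units"
    "u @ v < v @ u"
  shows "leads q (inv\<^bsub>nc_units\<^esub> f * inv\<^bsub>nc_units\<^esub> g * f * g - 1) (u @ v) 1"
proof -
  let ?f = "inv\<^bsub>nc_units\<^esub> f" and ?g = "inv\<^bsub>nc_units\<^esub> g"
  have fg: "nc_coeff f [] = 1" "nc_coeff g [] = 1" using assms by auto
  have "?f * ?g * (g * f) = ?f * (?g * g) * f" by (simp only: mult.assoc)
  then have "?f * ?g * (g * f) = 1" using nc_units_inv[OF fg(1)] nc_units_inv[OF fg(2)] by simp
  then have *: "?f * ?g * f * g - 1 = (?f * ?g) * ((f - 1) * (g - 1) + - ((g - 1) * (f - 1)))"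
    by (simp add: algebra_simps)
  have "sl_less (u @ v) (v @ u)" using assms(5) by (simp add: sl_less_def)
  then have "leads q ((f - 1) * (g - 1) + - ((g - 1) * (f - 1))) (u @ v) 1"
    using leads_add_higher[OF leads_mult[OF assms(1,2)] leads_uminus[OF leads_mult[OF assms(2,1)]]]
    by simp
  from leads_mult[OF leads_Nil[of q "?f * ?g"] this] show ?thesis
    unfolding * using nc_units_inv(1) fg by simp
qed

section \<open>Commutators and the lower central series\<close>

definition gcomm :: "('a, 'b) monoid_scheme \<Rightarrow> 'a \<Rightarrow> 'a \<Rightarrow> 'a" where
  "gcomm G x y = inv\<^bsub>G\<^esub> x \<otimes>\<^bsub>G\<^esub> inv\<^bsub>G\<^esub> y \<otimes>\<^bsub>G\<^esub> x \<otimes>\<^bsub>G\<^esub> y"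

lemma comm_sub_gcomm: "comm_sub G H K = generate G {gcomm G x y | x y. x \<in> H \<and> y \<in> K}"
  by (simp add: comm_sub_def gcomm_def)

context group
begin

lemma cancel_assoc:
  "x \<in> carrier G \<Longrightarrow> y \<in> carrier G \<Longrightarrow> x \<otimes> (inv x \<otimes> y) = y"
  "x \<in> carrier G \<Longrightarrow> y \<in> carrier G \<Longrightarrow> inv x \<otimes> (x \<otimes> y) = y"
  by (simp_all flip: m_assoc)

text \<open>Products nested to the right with adjacent inverses cancelled: a normal form for words,
  by which simplification verifies commutator identities such as Hall-Witt.\<close>

lemmas word_simps = gcomm_def m_assoc inv_mult_group cancel_assoc

lemma gcomm_closed [simp]: "x \<in> carrier G \<Longrightarrow> y \<in> carrier G \<Longrightarrow> gcomm G x y \<in> carrier G"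
  by (simp add: gcomm_def)

lemma inv_gcomm: "x \<in> carrier G \<Longrightarrow> y \<in> carrier G \<Longrightarrow> inv (gcomm G x y) = gcomm G y x"
  by (simp add: word_simps)

lemma gcomm_self: "x \<in> carrier G \<Longrightarrow> gcomm G x x = \<one>"
  by (simp add: word_simps)

lemma hall_witt:
  assumes "x \<in> carrier G" "y \<in> carrier G" "z \<in> carrier G"
  shows "(inv y \<otimes> gcomm G (gcomm G x (inv y)) z \<otimes> y)
       \<otimes> ((inv z \<otimes> gcomm G (gcomm G y (inv z)) x \<otimes> z)
       \<otimes> (inv x \<otimes> gcomm G (gcomm G z (inv x)) y \<otimes> x)) = \<one>"
  using assms by (simp add: word_simps)

lemma gcomm_swap_mem:
  assumes "subgroup N G" "x \<in> carrier G" "y \<in> carrier G" "gcomm G x y \<in> N"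
  shows "gcomm G y x \<in> N"
  using subgroup.m_inv_closed[OF assms(1,4)] inv_gcomm assms by simp

lemma normal_if_gcomm_mem:
  assumes "subgroup N G" "\<And>k s. k \<in> N \<Longrightarrow> s \<in> carrier G \<Longrightarrow> gcomm G k s \<in> N"
  shows "N \<lhd> G"
  unfolding normal_inv_iff
proof (intro conjI ballI)
  fix x h assume x: "x \<in> carrier G" and h: "h \<in> N"
  have hG: "h \<in> carrier G" using subgroup.mem_carrier[OF assms(1) h] .
  have "x \<otimes> h \<otimes> inv x = h \<otimes> gcomm G h (inv x)" using x hG by (simp add: word_simps)
  then show "x \<otimes> h \<otimes> inv x \<in> N"
    using subgroup.m_closed[OF assms(1) h assms(2)[OF h]] x by simp
qed (rule assms)

text \<open>Commutators with a product are products of conjugates of commutators, which a normal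
  subgroup absorbs. The use is to pass from generators to everything they generate.\<close>

lemma subgroup_gcomm_right:
  assumes "N \<lhd> G" "x \<in> carrier G"
  shows "subgroup {y \<in> carrier G. gcomm G x y \<in> N} G"
proof (rule subgroupI)
  interpret N: normal N G by fact
  show "{y \<in> carrier G. gcomm G x y \<in> N} \<noteq> {}"
    using assms(2) by (auto simp: word_simps intro!: exI[of _ \<one>])
  fix a assume a: "a \<in> {y \<in> carrier G. gcomm G x y \<in> N}"
  have "gcomm G x (inv a) = a \<otimes> inv (gcomm G x a) \<otimes> inv a"
    using a assms(2) by (simp add: word_simps)
  then show "inv a \<in> {y \<in> carrier G. gcomm G x y \<in> N}"
    using a N.inv_op_closed2 by simp
  fix b assume b: "b \<in> {y \<in> carrier G. gcomm G x y \<in> N}"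
  have "gcomm G x (a \<otimes> b) = gcomm G x b \<otimes> (inv b \<otimes> gcomm G x a \<otimes> b)"
    using a b assms(2) by (simp add: word_simps)
  then show "a \<otimes> b \<in> {y \<in> carrier G. gcomm G x y \<in> N}"
    using a b N.inv_op_closed1 by simp
qed auto

lemma subgroup_gcomm_left:
  assumes "N \<lhd> G" "y \<in> carrier G"
  shows "subgroup {x \<in> carrier G. gcomm G x y \<in> N} G"
proof -
  have "subgroup N G" using assms(1) by (rule normal_imp_subgroup)
  then have "{x \<in> carrier G. gcomm G x y \<in> N} = {x \<in> carrier G. gcomm G y x \<in> N}"
    using gcomm_swap_mem assms(2) by blast
  then show ?thesis using subgroup_gcomm_right[OF assms] by simp
qed

lemma generate_subset:
  assumes "subgroup H G" "A \<subseteq> H"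
  shows "generate G A \<subseteq> H"
  using assms generate_subgroup_incl by blast

text \<open>Hall-Witt with \<open>inv y\<close> for \<open>y\<close>: three conjugates multiply to 1
  and two of them lie in \<open>N\<close>, so the third does as well. The inverses inside the
  commutators remain and are removed in \<open>lower_central_jacobi\<close>.\<close>

lemma gcomm_jacobi:
  assumes "N \<lhd> G" "x \<in> carrier G" "y \<in> carrier G" "z \<in> carrier G"
    "gcomm G (gcomm G (inv y) (inv z)) x \<in> N" "gcomm G (gcomm G z (inv x)) (inv y) \<in> N"
  shows "gcomm G (gcomm G x y) z \<in> N"
proof -
  interpret N: normal N G by fact
  define A where "A = gcomm G (gcomm G x y) z"
  define B where "B = (inv z \<otimes> gcomm G (gcomm G (inv y) (inv z)) x \<otimes> z)
       \<otimes> (inv x \<otimes> gcomm G (gcomm G z (inv x)) (inv y) \<otimes> x)"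
  have B: "B \<in> N" unfolding B_def
    by (rule N.m_closed[OF N.inv_op_closed1[OF assms(4,5)] N.inv_op_closed1[OF assms(2,6)]])
  have A: "A \<in> carrier G" using assms(2-4) by (simp add: A_def)
  have *: "(y \<otimes> A \<otimes> inv y) \<otimes> B = \<one>"
    unfolding A_def B_def using hall_witt[of x "inv y" z] assms(2-4) by (simp only: inv_closed inv_inv)
  have "y \<otimes> A \<otimes> inv y = inv B"
    using A assms(3) N.mem_carrier[OF B] by (intro inv_equality[OF *, symmetric]) simp_all
  then have "y \<otimes> A \<otimes> inv y \<in> N" using N.m_inv_closed[OF B] by simp
  then have "inv y \<otimes> (y \<otimes> A \<otimes> inv y) \<otimes> y \<in> N" using N.inv_op_closed1[OF assms(3)] by blast
  then show ?thesis
    using A assms(3) unfolding A_def by (simp add: m_assoc cancel_assoc)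
qed

section \<open>The lower central series and commutators modulo its next term\<close>

lemma lower_central_Suc:
  "1 \<le> i \<Longrightarrow> lower_central G (Suc i) = comm_sub G (lower_central G i) (carrier G)"
  by (cases i) auto

lemma lower_central_le_1: "i \<le> 1 \<Longrightarrow> lower_central G i = carrier G"
  by (cases i) auto

text \<open>The two claims feed each other: an element of a term lies in the preceding one, so its
  commutators are generators of the term itself, which gives normality and the next inclusion at
  once.\<close>

lemma lower_central_normal_chain:
  "lower_central G i \<lhd> G \<and> lower_central G (Suc i) \<subseteq> lower_central G i"
proof (induction i)
  case 0
  show ?case using normal_self by simp
next
  case (Suc i)
  show ?case
  proof (cases "i = 0")
    case True
    have "comm_sub G (carrier G) (carrier G) \<subseteq> carrier G"
      unfolding comm_sub_gcomm by (intro generate_subset subgroup_self) auto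
    then show ?thesis using True normal_self by simp
  next
    case False
    let ?N = "lower_central G (Suc i)"
    have N: "?N = comm_sub G (lower_central G i) (carrier G)"
      using False by (intro lower_central_Suc) simp
    have sub: "lower_central G i \<subseteq> carrier G"
      using Suc normal_imp_subgroup subgroup.subset by blast
    have sg: "subgroup ?N G"
      unfolding N comm_sub_gcomm using sub by (intro generate_is_subgroup) auto
    have mem: "gcomm G k s \<in> ?N" if "k \<in> ?N" "s \<in> carrier G" for k s
    proof -
      have "k \<in> lower_central G i" using that(1) Suc by blast
      then show ?thesis unfolding N comm_sub_gcomm using that by (intro generate.incl) blast
    qed
    have "lower_central G (Suc (Suc i)) \<subseteq> ?N"
      unfolding lower_central.simps(3) comm_sub_gcomm
      using mem by (intro generate_subset sg) auto
    then show ?thesis using normal_if_gcomm_mem[OF sg mem] by blast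
  qed
qed

lemma lower_central_normal: "lower_central G i \<lhd> G"
  by (rule lower_central_normal_chain[THEN conjunct1])

lemma lower_central_subgroup: "subgroup (lower_central G i) G"
  by (rule normal_imp_subgroup[OF lower_central_normal])

lemma lower_central_carrier: "x \<in> lower_central G i \<Longrightarrow> x \<in> carrier G"
  by (rule subgroup.mem_carrier[OF lower_central_subgroup])

lemma lower_central_antimono: "i \<le> j \<Longrightarrow> lower_central G j \<subseteq> lower_central G i"
  by (rule lift_Suc_antimono_le[of "lower_central G", OF lower_central_normal_chain[THEN conjunct2]])

text \<open>Induction on \<open>j\<close> with \<open>i\<close> left free. For a generator
  \<open>gcomm G a s\<close> of the term \<open>Suc j\<close>, Hall-Witt moves \<open>s\<close> next
  to \<open>x\<close>, so that the induction hypothesis is needed at \<open>Suc i\<close> as well as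
  at \<open>i\<close>.\<close>

lemma lower_central_gcomm:
  "1 \<le> i \<Longrightarrow> 1 \<le> j \<Longrightarrow> x \<in> lower_central G i \<Longrightarrow> y \<in> lower_central G j
    \<Longrightarrow> gcomm G x y \<in> lower_central G (i + j)"
proof (induction j arbitrary: i x y)
  case (Suc j)
  show ?case
  proof (cases "j = 0")
    case True
    then show ?thesis
      using Suc.prems by (auto simp: lower_central_Suc comm_sub_gcomm intro!: generate.incl)
  next
    case False
    let ?N = "lower_central G (i + Suc j)"
    note normal = lower_central_normal[of "i + Suc j"] and sg = lower_central_subgroup
    have step: "gcomm G a s \<in> lower_central G (Suc k)"
      if "a \<in> lower_central G k" "s \<in> carrier G" "1 \<le> k" for a s k
      unfolding lower_central_Suc[OF that(3)] comm_sub_gcomm using that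
      by (intro generate.incl) blast
    have x: "x \<in> carrier G" using Suc.prems lower_central_carrier by blast
    have "gcomm G x (gcomm G a s) \<in> ?N" if a: "a \<in> lower_central G j" and s: "s \<in> carrier G" for a s
    proof -
      have aG: "a \<in> carrier G" using a lower_central_carrier by blast
      have "gcomm G (inv x) (inv s) \<in> lower_central G (Suc i)"
        using Suc.prems s by (intro step subgroup.m_inv_closed[OF sg]) auto
      then have "gcomm G (inv s) (inv x) \<in> lower_central G (Suc i)"
        using gcomm_swap_mem[OF sg] s x by simp
      then have 1: "gcomm G (gcomm G (inv s) (inv x)) a \<in> ?N"
        using Suc.IH[of "Suc i" "gcomm G (inv s) (inv x)" a] False a by simp
      have "gcomm G x (inv a) \<in> lower_central G (i + j)"
        using Suc.IH[of i x "inv a"] Suc.prems False a subgroup.m_inv_closed[OF sg] by simp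
      then have 2: "gcomm G (gcomm G x (inv a)) (inv s) \<in> ?N"
        using step[of "gcomm G x (inv a)" "i + j" "inv s"] s Suc.prems by simp
      have "gcomm G (gcomm G a s) x \<in> ?N"
        using gcomm_jacobi[OF normal aG s x 1 2] .
      then show ?thesis using gcomm_swap_mem[OF sg] x aG s by simp
    qed
    then have "{gcomm G a s | a s. a \<in> lower_central G j \<and> s \<in> carrier G}
        \<subseteq> {y \<in> carrier G. gcomm G x y \<in> ?N}"
      using lower_central_carrier by auto
    then have "lower_central G (Suc j) \<subseteq> {y \<in> carrier G. gcomm G x y \<in> ?N}"
      using generate_subset[OF subgroup_gcomm_right[OF normal x]] False
      by (simp add: lower_central_Suc comm_sub_gcomm)
    then show ?thesis using Suc.prems by blast
  qed
qed simp

text \<open>Consecutive terms have a central quotient, so nothing between them is moved by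
  conjugation.\<close>

lemma normal_between_lower_central:
  assumes "1 \<le> m" "subgroup N G" "lower_central G (Suc m) \<subseteq> N" "N \<subseteq> lower_central G m"
  shows "N \<lhd> G"
proof (rule normal_if_gcomm_mem[OF assms(2)])
  fix k s assume "k \<in> N" "s \<in> carrier G"
  then have "gcomm G k s \<in> lower_central G (m + 1)"
    using assms by (intro lower_central_gcomm) (auto simp: lower_central_le_1)
  then show "gcomm G k s \<in> N" using assms(3) by auto
qed

text \<open>Modulo the term after \<open>i + j\<close>, inverting an argument inverts the
  commutator: the correction is a commutator of weight \<open>i + j + i\<close>, which
  \<open>H\<close> contains.\<close>

lemma gcomm_inv_left_mem:
  assumes "1 \<le> i" "1 \<le> j" "x \<in> lower_central G i" "y \<in> lower_central G j"
    "subgroup H G" "lower_central G (Suc (i + j)) \<subseteq> H" "gcomm G x y \<in> H"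
  shows "gcomm G (inv x) y \<in> H"
proof -
  let ?c = "inv (gcomm G x y)"
  note sg = lower_central_subgroup
  have G: "x \<in> carrier G" "y \<in> carrier G" using assms lower_central_carrier by auto
  have "?c \<in> lower_central G (i + j)"
    using assms by (intro subgroup.m_inv_closed[OF sg] lower_central_gcomm)
  then have "gcomm G ?c (inv x) \<in> lower_central G (i + j + i)"
    using assms by (intro lower_central_gcomm subgroup.m_inv_closed[OF sg]) auto
  then have "gcomm G ?c (inv x) \<in> H"
    using assms lower_central_antimono[of "Suc (i + j)" "i + j + i"] by auto
  moreover have "?c \<in> H" using assms by (intro subgroup.m_inv_closed)
  moreover have "gcomm G (inv x) y = ?c \<otimes> gcomm G ?c (inv x)"
    using G by (simp add: word_simps)
  ultimately show ?thesis using subgroup.m_closed[OF assms(5)] by simp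
qed

lemma gcomm_inv_right_mem:
  assumes "1 \<le> i" "1 \<le> j" "x \<in> lower_central G i" "y \<in> lower_central G j"
    "subgroup H G" "lower_central G (Suc (i + j)) \<subseteq> H" "gcomm G x y \<in> H"
  shows "gcomm G x (inv y) \<in> H"
proof -
  have G: "x \<in> carrier G" "y \<in> carrier G" using assms lower_central_carrier by auto
  then have "gcomm G y x \<in> H" using gcomm_swap_mem[OF assms(5)] assms(7) by simp
  then have "gcomm G (inv y) x \<in> H"
    using assms by (intro gcomm_inv_left_mem[of j i]) (auto simp: add.commute)
  then show ?thesis using gcomm_swap_mem[OF assms(5)] G by simp
qed

text \<open>Modulo the next term of the series the commutator is bilinear, so the inverses in
  \<open>gcomm_jacobi\<close> amount to signs. The containment of
  \<open>lower_central G (Suc (i + j + k))\<close> in \<open>N\<close> absorbs the errors.\<close>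

lemma lower_central_jacobi:
  assumes "1 \<le> i" "1 \<le> j" "1 \<le> k"
    "a \<in> lower_central G i" "b \<in> lower_central G j" "c \<in> lower_central G k"
    "N \<lhd> G" "lower_central G (Suc (i + j + k)) \<subseteq> N"
    "gcomm G (gcomm G b c) a \<in> N" "gcomm G (gcomm G c a) b \<in> N"
  shows "gcomm G (gcomm G a b) c \<in> N"
proof -
  note sg = lower_central_subgroup
  have G: "a \<in> carrier G" "b \<in> carrier G" "c \<in> carrier G"
    using assms lower_central_carrier by auto
  have "gcomm G x a \<in> N" if "x \<in> lower_central G (Suc (j + k))" for x
    using lower_central_gcomm[OF _ assms(1) that assms(4)] assms(8) by (auto simp: ac_simps)
  \<comment> \<open>The subgroup of all \<open>x\<close> whose commutator with \<open>a\<close> is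
    in \<open>N\<close> contains \<open>gcomm G b c\<close> by assumption and the term
    \<open>Suc (j + k)\<close> by weight. It can thus play the role of \<open>H\<close> in the two
    inversion lemmas.\<close>
  then have 1: "gcomm G (inv b) (inv c) \<in> {x \<in> carrier G. gcomm G x a \<in> N}"
    using assms G lower_central_carrier
    by (intro gcomm_inv_left_mem[of j k] gcomm_inv_right_mem[of j k] subgroup_gcomm_left
        subgroup.m_inv_closed[OF sg]) auto
  have "gcomm G x b \<in> N" if "x \<in> lower_central G (Suc (k + i))" for x
    using lower_central_gcomm[OF _ assms(2) that assms(5)] assms(8) by (auto simp: ac_simps)
  then have "gcomm G c (inv a) \<in> {x \<in> carrier G. gcomm G x b \<in> N}"
    using assms G lower_central_carrier
    by (intro gcomm_inv_right_mem[of k i] subgroup_gcomm_left) auto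
  then have "gcomm G (gcomm G c (inv a)) (inv b) \<in> N"
    using subgroup.m_inv_closed[OF subgroup_gcomm_right[OF assms(7), of "gcomm G c (inv a)"], of b] G
    by simp
  then show ?thesis using gcomm_jacobi[OF assms(7) G] 1 by simp
qed

text \<open>The powers of \<open>a\<close> can be collected on the left because conjugation by them
  preserves \<open>N\<close>; this extracts one exponent of the normal form.\<close>

lemma generate_insert_normal:
  assumes "N \<lhd> G" "a \<in> carrier G" "s \<in> generate G (insert a N)"
  shows "\<exists>k :: int. \<exists>n\<in>N. s = a [^] k \<otimes> n"
  using assms(3)
proof (induction rule: generate.induct)
  interpret N: normal N G by fact
  case one
  show ?case by (intro exI[of _ 0] bexI[of _ \<one>]) auto
next
  interpret N: normal N G by fact
  case (incl h)
  show ?case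
  proof (cases "h = a")
    case True
    then show ?thesis using assms(2) by (intro exI[of _ 1] bexI[of _ \<one>]) auto
  next
    case False
    then show ?thesis using incl N.mem_carrier by (intro exI[of _ 0] bexI[of _ h]) auto
  qed
next
  interpret N: normal N G by fact
  case (inv h)
  show ?case
  proof (cases "h = a")
    case True
    then show ?thesis using assms(2)
      by (intro exI[of _ "-1"] bexI[of _ \<one>]) (auto simp: int_pow_neg)
  next
    case False
    then show ?thesis using inv N.mem_carrier by (intro exI[of _ 0] bexI[of _ "inv h"]) auto
  qed
next
  interpret N: normal N G by fact
  case (eng s t)
  then obtain k l :: int and m n where *: "m \<in> N" "n \<in> N" "s = a [^] k \<otimes> m" "t = a [^] l \<otimes> n"
    by blast
  then have G: "m \<in> carrier G" "n \<in> carrier G" using N.mem_carrier by auto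
  have "s \<otimes> t = a [^] (k + l) \<otimes> ((inv (a [^] l) \<otimes> m \<otimes> a [^] l) \<otimes> n)"
    using * G assms(2) by (simp add: m_assoc cancel_assoc int_pow_mult)
  moreover have "(inv (a [^] l) \<otimes> m \<otimes> a [^] l) \<otimes> n \<in> N"
    using *(1,2) N.inv_op_closed1 assms(2) by simp
  ultimately show ?case by blast
qed

end

section \<open>Lyndon brackets and generation of the lower central quotients\<close>

function bracket :: "('a, 'b) monoid_scheme \<Rightarrow> (nat \<Rightarrow> 'a) \<Rightarrow> nat list \<Rightarrow> 'a" where
  "bracket G b w = (if length w < 2 then b (hd w)
     else gcomm G (bracket G b (std_left w)) (bracket G b (std_right w)))"
  by pat_completeness auto
termination
  by (relation "measure (\<lambda>(G, b, w). length w)") (auto simp: std_length)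

declare bracket.simps [simp del]

text \<open>The letter \<open>j\<close> of a word stands for the generator \<open>b j\<close>.
  Existence of normal forms is a matter of generation alone; freeness enters with the map of
  \<open>magnus_group\<close>.\<close>

locale marked_group = group G for G (structure) +
  fixes b :: "nat \<Rightarrow> 'a" and d :: nat
  assumes b_closed: "j < d \<Longrightarrow> b j \<in> carrier G"
    and b_generate: "generate G (b ` {..<d}) = carrier G"
begin

abbreviation "br \<equiv> bracket G b"
abbreviation "\<gamma> \<equiv> lower_central G"

definition lyn :: "nat list \<Rightarrow> bool" where
  "lyn w \<longleftrightarrow> lyndon w \<and> set w \<subseteq> {..<d}"

lemma lyn_length: "lyn w \<Longrightarrow> 1 \<le> length w"
  by (cases w) (auto simp: lyn_def)

lemma lyn_std:
  assumes "lyn w" "2 \<le> length w"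
  shows "lyn (std_left w)" "lyn (std_right w)"
proof -
  have "set (std_left w) \<union> set (std_right w) = set w"
    using arg_cong[OF std_append(1)[OF assms(2)], of set] by simp
  then show "lyn (std_left w)" "lyn (std_right w)"
    using assms lyndon_std_left lyndon_std_right by (auto simp: lyn_def)
qed

lemma br_mem: "lyn w \<Longrightarrow> br w \<in> \<gamma> (length w)"
proof (induction "length w" arbitrary: w rule: less_induct)
  case less
  show ?case
  proof (cases "length w < 2")
    case True
    then obtain x where "w = [x]" using lyn_length[OF less.prems] by (cases w) auto
    then show ?thesis using less.prems b_closed by (simp add: bracket.simps lyn_def)
  next
    case False
    then have "2 \<le> length w" by simp
    note l = std_length[OF this] lyn_std[OF less.prems this]
    have "gcomm G (br (std_left w)) (br (std_right w)) \<in> \<gamma> (length (std_left w) + length (std_right w))"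
      using l less.hyps lyn_length by (intro lower_central_gcomm) auto
    then show ?thesis using False l(3) by (subst bracket.simps) simp
  qed
qed

lemma br_closed: "lyn w \<Longrightarrow> br w \<in> carrier G"
  using br_mem lower_central_carrier by blast

text \<open>The span of the weight \<open>m\<close> brackets inside the quotient of consecutive
  lower central terms, pulled back to a subgroup of \<open>G\<close>. The set \<open>A\<close>
  records a bound on the words, which the rewriting induction has to preserve.\<close>

definition spn :: "nat \<Rightarrow> nat list set \<Rightarrow> 'a set" where
  "spn m A = generate G (br ` {w \<in> A. lyn w \<and> length w = m} \<union> \<gamma> (Suc m))"

lemma spn_gen_subset: "br ` {w \<in> A. lyn w \<and> length w = m} \<union> \<gamma> (Suc m) \<subseteq> \<gamma> m"
  using br_mem lower_central_antimono[of m "Suc m"] by auto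

lemma spn_gen_carrier: "br ` {w \<in> A. lyn w \<and> length w = m} \<union> \<gamma> (Suc m) \<subseteq> carrier G"
  using spn_gen_subset lower_central_carrier by blast

lemma subgroup_spn: "subgroup (spn m A) G"
  unfolding spn_def by (rule generate_is_subgroup[OF spn_gen_carrier])

lemma spn_lower: "\<gamma> (Suc m) \<subseteq> spn m A"
  unfolding spn_def by (auto intro: generate.incl)

lemma spn_br: "w \<in> A \<Longrightarrow> lyn w \<Longrightarrow> length w = m \<Longrightarrow> br w \<in> spn m A"
  unfolding spn_def by (auto intro: generate.incl)

lemma spn_upper: "spn m A \<subseteq> \<gamma> m"
  unfolding spn_def by (rule generate_subset[OF lower_central_subgroup spn_gen_subset])

lemma spn_mono: "A \<subseteq> B \<Longrightarrow> spn m A \<subseteq> spn m B"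
  unfolding spn_def by (rule mono_generate) blast

lemma spn_normal: "1 \<le> m \<Longrightarrow> spn m A \<lhd> G"
  using normal_between_lower_central[OF _ subgroup_spn spn_lower spn_upper] .

text \<open>Linearity: an estimate for commutators with brackets extends to their span, while the
  elements of the next term are handled by weight.\<close>

lemma spn_gcomm_left:
  assumes "x \<in> spn m A" "y \<in> \<gamma> k" "1 \<le> m" "1 \<le> k" "N \<lhd> G" "\<gamma> (Suc (m + k)) \<subseteq> N"
    "\<And>w. w \<in> A \<Longrightarrow> lyn w \<Longrightarrow> length w = m \<Longrightarrow> gcomm G (br w) y \<in> N"
  shows "gcomm G x y \<in> N"
proof -
  have "gcomm G z y \<in> N" if "z \<in> \<gamma> (Suc m)" for z
    using lower_central_gcomm[OF _ assms(4) that assms(2)] assms(6) by auto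
  then have "spn m A \<subseteq> {x \<in> carrier G. gcomm G x y \<in> N}"
    unfolding spn_def using assms br_closed lower_central_carrier
    by (intro generate_subset subgroup_gcomm_left) auto
  then show ?thesis using assms(1) by blast
qed

text \<open>The lexicographic order has infinite descents such as \<open>[1]\<close>,
  \<open>[0,1]\<close>, \<open>[0,0,1]\<close>. With length and alphabet bounded, counting the
  smaller words gives a measure for the induction.\<close>

definition word_rank :: "nat \<Rightarrow> nat list \<Rightarrow> nat" where
  "word_rank n v = card {x. set x \<subseteq> {..<d} \<and> length x \<le> n \<and> x < v}"

lemma word_rank_less:
  assumes "v < v'" "set v \<subseteq> {..<d}" "length v \<le> n"
  shows "word_rank n v < word_rank n v'"
  unfolding word_rank_def
proof (rule psubset_card_mono)
  have "finite {x. set x \<subseteq> {..<d} \<and> length x \<le> n}" by (rule finite_lists_length_le) simp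
  then show "finite {x. set x \<subseteq> {..<d} \<and> length x \<le> n \<and> x < v'}"
    by (rule rev_finite_subset) blast
  show "{x. set x \<subseteq> {..<d} \<and> length x \<le> n \<and> x < v} \<subset> {x. set x \<subseteq> {..<d} \<and> length x \<le> n \<and> x < v'}"
    using assms by auto
qed

text \<open>If \<open>(u, v)\<close> is not the standard factorization of \<open>u @ v\<close>, then \<open>u\<close> factors as \<open>x @ y\<close> with \<open>y < v\<close>,
  and the Jacobi identity replaces \<open>[[x, y], v]\<close> by \<open>[[y, v], x]\<close> and \<open>[[v, x], y]\<close>. By induction on the
  total length, the inner commutators are spanned by brackets of words below \<open>v\<close>, so that the outer
  ones have a smaller maximal argument at the same total length.\<close>

lemma gcomm_br_mem:
  "lyn u \<Longrightarrow> lyn v \<Longrightarrow> u < v \<Longrightarrow> length u + length v = n \<Longrightarrow> gcomm G (br u) (br v) \<in> spn n {..<v}"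
proof (induction n arbitrary: u v rule: less_induct)
  case (less n)
  note IH_length = less.IH
  show ?case using less.prems
  proof (induction "word_rank n v" arbitrary: u v rule: less_induct)
    case (less v u)
    \<comment> \<open>Both inductions in one statement: smaller total length, or the same length
      with both words below \<open>v\<close>. The order of the arguments is immaterial, since a swap
      inverts the commutator and equal words give the identity; the brackets obtained lie below the
      larger argument, hence below \<open>v\<close>.\<close>
    have IH: "gcomm G (br x) (br y) \<in> spn (length x + length y) {..<v}"
      if "lyn x" "lyn y" "x \<le> v" "y \<le> v" "length x + length y < n \<or> length x + length y = n \<and> x < v \<and> y < v"
      for x y
    proof -
      have *: "gcomm G (br x) (br y) \<in> spn (length x + length y) {..<v}"
        if xy: "lyn x" "lyn y" "x < y" "y \<le> v"
          "length x + length y < n \<or> length x + length y = n \<and> y < v" for x y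
      proof -
        have "gcomm G (br x) (br y) \<in> spn (length x + length y) {..<y}"
        proof (cases "length x + length y < n")
          case True
          then show ?thesis using IH_length xy by blast
        next
          case False
          then have "word_rank n y < word_rank n v"
            using xy by (intro word_rank_less) (auto simp: lyn_def)
          then show ?thesis using less.hyps[of y x] xy False by blast
        qed
        then show ?thesis using spn_mono[of "{..<y}" "{..<v}"] xy(4) by auto
      qed
      consider "x < y" | "x = y" | "y < x" by fastforce
      then show ?thesis
      proof cases
        case 1
        then show ?thesis using * that by blast
      next
        case 2
        then show ?thesis
          using gcomm_self br_closed[OF that(1)] subgroup.one_closed[OF subgroup_spn] by simp
      next
        case 3
        then have "gcomm G (br y) (br x) \<in> spn (length y + length x) {..<v}"
          using that by (intro *) auto
        then show ?thesis
          using gcomm_swap_mem[OF subgroup_spn] br_closed that by (simp add: add.commute)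
      qed
    qed
    show ?case
    proof (cases "2 \<le> length u \<and> std_right u < v")
      case False
      have uv: "std_right (u @ v) = v" "std_left (u @ v) = u"
        using less.prems False by (intro std_append_eq; auto simp: lyn_def)+
      have "\<not> length (u @ v) < 2"
        using lyn_length[OF less.prems(1)] lyn_length[OF less.prems(2)] by simp
      then have "gcomm G (br u) (br v) = br (u @ v)"
        by (simp only: bracket.simps[of G b "u @ v"] uv if_False)
      \<comment> \<open>The factorization is standard here, so the commutator is itself a bracket,
        and \<open>u @ v < v\<close> puts its word below the bound.\<close>
      moreover have "br (u @ v) \<in> spn n {..<v}"
        using less.prems lyndon_append lyndon_append_less by (intro spn_br) (auto simp: lyn_def)
      ultimately show ?thesis by simp
    next
      case True
      define x y where "x = std_left u" and "y = std_right u"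
      have l: "length x < length u" "length y < length u" "length x + length y = length u"
        using std_length True by (auto simp: x_def y_def)
      have ly: "lyn x" "lyn y" using lyn_std less.prems(1) True by (auto simp: x_def y_def)
      have "x @ y = u" "y \<noteq> []" using std_append[of u] True by (auto simp: x_def y_def)
      then have "x < u" using lex_less_append by blast
      then have xyv: "x < v" "y < v" using less.prems True by (auto simp: y_def)
      have n: "1 \<le> n" using less.prems(4) lyn_length[OF less.prems(1)] by simp
      have len: "1 \<le> length x" "1 \<le> length y" "1 \<le> length v"
        using ly less.prems lyn_length by auto
      note normal = spn_normal[OF n, of "{..<v}"]
      have u: "br u = gcomm G (br x) (br y)"
        using True unfolding x_def y_def by (subst bracket.simps) simp
      have uv: "lyn v" "length u + length v = n" using less.prems by blast+
      have \<gamma>_sub: "\<gamma> (Suc k) \<subseteq> spn n {..<v}" if "k = n" for k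
        using spn_lower that by simp
      have "gcomm G (gcomm G (br y) (br v)) (br x) \<in> spn n {..<v}"
      proof (rule spn_gcomm_left[OF _ br_mem[OF ly(1)] _ len(1) normal])
        show "gcomm G (br y) (br v) \<in> spn (length y + length v) {..<v}"
          by (rule IH) (use xyv ly uv l in linarith | use xyv ly uv in fastforce)+
        show "\<gamma> (Suc (length y + length v + length x)) \<subseteq> spn n {..<v}"
          by (rule \<gamma>_sub) (use l uv in linarith)
        fix w assume w: "w \<in> {..<v}" "lyn w" "length w = length y + length v"
        then have "length w + length x = n" using l uv by linarith
        moreover from this have "gcomm G (br w) (br x) \<in> spn (length w + length x) {..<v}"
          by (intro IH) (use w ly xyv in auto)
        ultimately show "gcomm G (br w) (br x) \<in> spn n {..<v}" by simp
      qed (use len in simp)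
      moreover have "gcomm G (gcomm G (br v) (br x)) (br y) \<in> spn n {..<v}"
      proof (rule spn_gcomm_left[OF _ br_mem[OF ly(2)] _ len(2) normal])
        show "gcomm G (br v) (br x) \<in> spn (length v + length x) {..<v}"
          by (rule IH) (use xyv ly uv l in linarith | use xyv ly uv in fastforce)+
        show "\<gamma> (Suc (length v + length x + length y)) \<subseteq> spn n {..<v}"
          by (rule \<gamma>_sub) (use l uv in linarith)
        fix w assume w: "w \<in> {..<v}" "lyn w" "length w = length v + length x"
        then have "length w + length y = n" using l uv by linarith
        moreover from this have "gcomm G (br w) (br y) \<in> spn (length w + length y) {..<v}"
          by (intro IH) (use w ly xyv in auto)
        ultimately show "gcomm G (br w) (br y) \<in> spn n {..<v}" by simp
      qed (use len in simp)
      moreover have "\<gamma> (Suc (length x + length y + length v)) \<subseteq> spn n {..<v}"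
        by (rule \<gamma>_sub) (use l uv in linarith)
      ultimately show ?thesis
        unfolding u
        using lower_central_jacobi[OF len br_mem[OF ly(1)] br_mem[OF ly(2)] br_mem[OF uv(1)] normal]
        by blast
    qed
  qed
qed

text \<open>A single letter is a Lyndon word, so the commutator of a bracket with a generator falls
  under \<open>gcomm_br_mem\<close> in one of the two orders. The bounds on the words have done
  their work there and are dropped.\<close>

lemma lower_central_spn: "\<gamma> (Suc m) \<subseteq> spn (Suc m) UNIV"
proof (induction m)
  case 0
  have "b ` {..<d} \<subseteq> spn 1 UNIV"
  proof (rule image_subsetI, unfold lessThan_iff)
    fix j assume "j < d"
    then have "lyn [j]" by (simp add: lyn_def)
    then have "br [j] \<in> spn 1 UNIV" by (intro spn_br) simp_all
    then show "b j \<in> spn 1 UNIV" by (simp add: bracket.simps)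
  qed
  then have "generate G (b ` {..<d}) \<subseteq> spn 1 UNIV" by (rule generate_subset[OF subgroup_spn])
  then show ?case using b_generate by simp
next
  case (Suc m)
  let ?N = "spn (Suc (Suc m)) UNIV"
  have normal: "?N \<lhd> G" by (rule spn_normal) simp
  have up: "spn n A \<subseteq> spn n UNIV" for n A by (rule spn_mono) simp
  have gen: "gcomm G x (b j) \<in> ?N" if x: "x \<in> \<gamma> (Suc m)" and j: "j < d" for x j
  proof (rule spn_gcomm_left[of x "Suc m" UNIV "b j" 1])
    have lj: "lyn [j]" "br [j] = b j" using j by (auto simp: lyn_def bracket.simps)
    show "x \<in> spn (Suc m) UNIV" using x Suc by blast
    show "b j \<in> \<gamma> 1" using b_closed[OF j] by simp
    show "\<gamma> (Suc (Suc m + 1)) \<subseteq> ?N" using spn_lower[of "Suc (Suc m)"] by simp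
    show "?N \<lhd> G" by (rule normal)
    fix w assume w: "lyn w" "length w = Suc m"
    consider "w < [j]" | "w = [j]" | "[j] < w" using linorder_less_linear by blast
    then show "gcomm G (br w) (b j) \<in> ?N"
    proof cases
      case 1
      have "gcomm G (br w) (br [j]) \<in> spn (Suc (Suc m)) {..<[j]}"
        using w by (intro gcomm_br_mem lj(1) 1) simp_all
      then show ?thesis unfolding lj(2) using up by blast
    next
      case 2
      then show ?thesis
        using lj gcomm_self b_closed[OF j] subgroup.one_closed[OF subgroup_spn] by simp
    next
      case 3
      have "gcomm G (br [j]) (br w) \<in> spn (Suc (Suc m)) {..<w}"
        using w by (intro gcomm_br_mem lj(1) 3) simp_all
      then have "gcomm G (b j) (br w) \<in> ?N" unfolding lj(2) using up by blast
      then show ?thesis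
        by (rule gcomm_swap_mem[OF subgroup_spn b_closed[OF j] br_closed[OF w(1)]])
    qed
  qed simp_all
  have "gcomm G x s \<in> ?N" if x: "x \<in> \<gamma> (Suc m)" and s: "s \<in> carrier G" for x s
  proof -
    have "b ` {..<d} \<subseteq> {s \<in> carrier G. gcomm G x s \<in> ?N}"
      using gen[OF x] b_closed by blast
    then have "generate G (b ` {..<d}) \<subseteq> {s \<in> carrier G. gcomm G x s \<in> ?N}"
      by (rule generate_subset[OF subgroup_gcomm_right[OF normal lower_central_carrier[OF x]]])
    then show ?thesis using s b_generate by blast
  qed
  then have "{gcomm G x y |x y. x \<in> \<gamma> (Suc m) \<and> y \<in> carrier G} \<subseteq> ?N" by blast
  then show ?case
    unfolding lower_central.simps(3) comm_sub_gcomm by (rule generate_subset[OF subgroup_spn])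
qed

section \<open>Normal forms as products of powers of brackets\<close>

definition br_prod :: "(nat list \<times> int) list \<Rightarrow> 'a" where
  "br_prod es = foldr (\<lambda>(w, e) x. br w [^] e \<otimes> x) es \<one>"

lemma br_prod_simps [simp]:
  "br_prod [] = \<one>" "br_prod ((w, e) # es) = br w [^] e \<otimes> br_prod es"
  by (simp_all add: br_prod_def)

lemma br_prod_closed [simp]: "\<forall>(w, e)\<in>set es. lyn w \<Longrightarrow> br_prod es \<in> carrier G"
  by (induction es) (auto simp: br_closed)

lemma br_prod_append:
  "\<forall>(w, e)\<in>set (es @ fs). lyn w \<Longrightarrow> br_prod (es @ fs) = br_prod es \<otimes> br_prod fs"
  by (induction es) (auto simp: br_closed m_assoc)

text \<open>Within one weight, words are split off one at a time; what remains is spanned by the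
  other words, so no word recurs. Zero exponents are skipped, which makes the \<open>p\<close>-adic
  valuation of every exponent meaningful later.\<close>

lemma spn_normal_form:
  assumes "finite A" "1 \<le> m" "s \<in> spn m A"
  shows "\<exists>es g. distinct (map fst es) \<and> (\<forall>(w, e)\<in>set es. w \<in> A \<and> lyn w \<and> length w = m \<and> e \<noteq> 0)
    \<and> g \<in> \<gamma> (Suc m) \<and> s = br_prod es \<otimes> g"
  using assms(1,3)
proof (induction A arbitrary: s rule: finite_induct)
  case empty
  then have "s \<in> \<gamma> (Suc m)"
    unfolding spn_def using generate_subset[OF lower_central_subgroup, of "\<gamma> (Suc m)" "Suc m"] by auto
  then show ?case using lower_central_carrier by (intro exI[of _ "[]"] exI[of _ s]) auto
next
  case (insert w A)
  show ?case
  proof (cases "lyn w \<and> length w = m")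
    case False
    then have "{x \<in> insert w A. lyn x \<and> length x = m} = {x \<in> A. lyn x \<and> length x = m}" by blast
    then have "s \<in> spn m A" using insert.prems by (simp add: spn_def)
    from insert.IH[OF this] show ?thesis by fastforce
  next
    case True
    have "spn m (insert w A) \<subseteq> generate G (insert (br w) (spn m A))"
      unfolding spn_def[of m "insert w A"]
      using spn_lower spn_br by (intro mono_generate) auto
    then obtain k :: int and t where k: "t \<in> spn m A" "s = br w [^] k \<otimes> t"
      using generate_insert_normal[OF spn_normal[OF assms(2)] br_closed, of w s A] True insert.prems
      by blast
    from insert.IH[OF k(1)] obtain es g where es: "distinct (map fst es)"
      "\<forall>(w, e)\<in>set es. w \<in> A \<and> lyn w \<and> length w = m \<and> e \<noteq> 0" "g \<in> \<gamma> (Suc m)" "t = br_prod es \<otimes> g"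
      by blast
    have closed: "br_prod es \<in> carrier G" "g \<in> carrier G" "br w \<in> carrier G"
      using es lower_central_carrier br_closed True by (auto intro!: br_prod_closed)
    show ?thesis
    proof (cases "k = 0")
      case True
      then have "s = t" using k(2) es(4) closed by simp
      then show ?thesis using es by fastforce
    next
      case False
      have "w \<notin> set (map fst es)" using es(2) insert.hyps(2) by auto
      moreover have "s = br_prod ((w, k) # es) \<otimes> g"
        using k(2) es(4) closed by (simp add: m_assoc)
      ultimately show ?thesis
        using es True False by (intro exI[of _ "(w, k) # es"] exI[of _ g]) auto
    qed
  qed
qed

text \<open>The remainder is expanded by one weight at a time. Words from different rounds differ in
  length, hence stay distinct.\<close>

lemma lyndon_normal_form:
  assumes "s \<in> carrier G"
  shows "\<exists>es g. distinct (map fst es) \<and> (\<forall>(w, e)\<in>set es. lyn w \<and> length w \<le> m \<and> e \<noteq> 0)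
    \<and> g \<in> \<gamma> (Suc m) \<and> s = br_prod es \<otimes> g"
proof (induction m)
  case 0
  show ?case using assms by (intro exI[of _ "[]"] exI[of _ s]) auto
next
  case (Suc m)
  then obtain es g where es: "distinct (map fst es)" "\<forall>(w, e)\<in>set es. lyn w \<and> length w \<le> m \<and> e \<noteq> 0"
    "g \<in> \<gamma> (Suc m)" "s = br_prod es \<otimes> g" by blast
  define A where "A = {w. set w \<subseteq> {..<d} \<and> length w = Suc m}"
  have "finite A" unfolding A_def by (rule finite_lists_length_eq) simp
  have "{w \<in> UNIV. lyn w \<and> length w = Suc m} = {w \<in> A. lyn w \<and> length w = Suc m}"
    by (auto simp: A_def lyn_def)
  then have "g \<in> spn (Suc m) A"
    using lower_central_spn[of m] es(3) unfolding spn_def by auto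
  then obtain fs h where fs: "distinct (map fst fs)"
    "\<forall>(w, e)\<in>set fs. w \<in> A \<and> lyn w \<and> length w = Suc m \<and> e \<noteq> 0"
    "h \<in> \<gamma> (Suc (Suc m))" "g = br_prod fs \<otimes> h"
    using spn_normal_form[OF \<open>finite A\<close>, of "Suc m" g] by auto
  have "fst ` set es \<inter> fst ` set fs = {}" using es(2) fs(2) by fastforce
  then have "distinct (map fst (es @ fs))" using es(1) fs(1) by simp
  moreover have "s = br_prod (es @ fs) \<otimes> h"
  proof -
    have "br_prod es \<in> carrier G" "br_prod fs \<in> carrier G"
      using es fs by (auto intro!: br_prod_closed)
    moreover have "h \<in> carrier G" by (rule lower_central_carrier[OF fs(3)])
    moreover have "br_prod (es @ fs) = br_prod es \<otimes> br_prod fs"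
      using es fs by (intro br_prod_append) auto
    ultimately show ?thesis using es(4) fs(4) by (simp add: m_assoc)
  qed
  moreover have "\<forall>(w, e)\<in>set (es @ fs). lyn w \<and> length w \<le> Suc m \<and> e \<noteq> 0"
    using es(2) fs(2) by fastforce
  ultimately show ?case using fs(3) by blast
qed

end

section \<open>Free groups and unitriangular representations\<close>

definition map_word :: "('a \<Rightarrow> 'c) \<Rightarrow> (bool \<times> 'a) list \<Rightarrow> (bool \<times> 'c) list" where
  "map_word f w = map (\<lambda>(e, x). (e, f x)) w"

definition inv_word :: "(bool \<times> 'a) list \<Rightarrow> (bool \<times> 'a) list" where
  "inv_word w = rev (map (\<lambda>(e, x). (\<not> e, x)) w)"

lemma map_word_simps [simp]:
  "map_word f [] = []" "map_word f ((e, x) # w) = (e, f x) # map_word f w"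
  "map_word f (u @ v) = map_word f u @ map_word f v"
  "map_word f (inv_word w) = inv_word (map_word f w)"
  by (auto simp: map_word_def inv_word_def rev_map)

lemma inv_word_simps [simp]: "inv_word [] = []" "inv_word ((e, x) # w) = inv_word w @ [(\<not> e, x)]"
  by (simp_all add: inv_word_def)

lemma letters_inv_word [simp]: "snd ` set (inv_word w) = snd ` set w"
  by (simp add: inv_word_def image_image case_prod_unfold)

lemma letters_map_word: "snd ` set (map_word f w) = f ` snd ` set w"
  by (simp add: map_word_def image_image case_prod_unfold)

lemma (in group) eval_word_closed:
  "snd ` set w \<subseteq> carrier G \<Longrightarrow> eval_word G w \<in> carrier G"
  by (induction G\<equiv>G w rule: eval_word.induct) auto

lemma (in group) eval_word_append:
  "snd ` set (u @ v) \<subseteq> carrier G \<Longrightarrow> eval_word G (u @ v) = eval_word G u \<otimes> eval_word G v"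
proof (induction u)
  case (Cons a u)
  obtain e x where a: "a = (e, x)" by (cases a)
  have "eval_word G u \<in> carrier G" "eval_word G v \<in> carrier G" "x \<in> carrier G"
    using Cons.prems a by (auto intro!: eval_word_closed)
  then show ?case using Cons a by (simp add: m_assoc)
qed (simp add: eval_word_closed)

lemma (in group) eval_inv_word:
  "snd ` set w \<subseteq> carrier G \<Longrightarrow> eval_word G (inv_word w) = inv (eval_word G w)"
proof (induction w)
  case (Cons a w)
  obtain e x where a: "a = (e, x)" by (cases a)
  have "eval_word G w \<in> carrier G" "x \<in> carrier G"
    using Cons.prems a by (auto intro!: eval_word_closed)
  moreover have "eval_word G (inv_word w @ [(\<not> e, x)])
      = eval_word G (inv_word w) \<otimes> eval_word G [(\<not> e, x)]"
    using Cons.prems a letters_inv_word[of w] by (intro eval_word_append) auto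
  ultimately show ?case using Cons a by (simp add: inv_mult_group)
qed simp

lemma not_reduced_word:
  "\<not> reduced_word w \<Longrightarrow> \<exists>u e x v. w = u @ (e, x) # (\<not> e, x) # v"
proof (induction w rule: reduced_word.induct)
  case (3 e x f y w)
  show ?case
  proof (cases "x = y \<and> e \<noteq> f")
    case True
    then have "(e, x) # (f, y) # w = [] @ (e, x) # (\<not> e, x) # w" by simp
    then show ?thesis by blast
  next
    case False
    then have "\<not> reduced_word ((f, y) # w)" using "3.prems" by simp
    then obtain u e' x' v where "(f, y) # w = u @ (e', x') # (\<not> e', x') # v" using "3.IH" by blast
    then have "(e, x) # (f, y) # w = ((e, x) # u) @ (e', x') # (\<not> e', x') # v" by simp
    then show ?thesis by blast
  qed
qed auto

lemma (in group) eval_word_cancel: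
  assumes "snd ` set (u @ (e, x) # (\<not> e, x) # v) \<subseteq> carrier G"
  shows "eval_word G (u @ (e, x) # (\<not> e, x) # v) = eval_word G (u @ v)"
proof -
  have G: "eval_word G u \<in> carrier G" "eval_word G v \<in> carrier G" "x \<in> carrier G"
    using assms by (auto intro!: eval_word_closed)
  have "eval_word G ((e, x) # (\<not> e, x) # v) = eval_word G v"
    using G by (simp add: cancel_assoc)
  moreover have "eval_word G (u @ (e, x) # (\<not> e, x) # v)
      = eval_word G u \<otimes> eval_word G ((e, x) # (\<not> e, x) # v)"
    using assms by (intro eval_word_append)
  moreover have "eval_word G (u @ v) = eval_word G u \<otimes> eval_word G v"
    using assms by (intro eval_word_append) auto
  ultimately show ?thesis by simp
qed

text \<open>By freeness a nonempty word with value 1 is not reduced, so it contains a cancelling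
  pair, whose image also cancels in \<open>H\<close>. Removing it shortens the word.\<close>

lemma free_group_eval_one:
  assumes "free_group_on S B" "group H" "f ` B \<subseteq> carrier H"
  shows "snd ` set w \<subseteq> B \<Longrightarrow> eval_word S w = \<one>\<^bsub>S\<^esub> \<Longrightarrow> eval_word H (map_word f w) = \<one>\<^bsub>H\<^esub>"
proof (induction "length w" arbitrary: w rule: less_induct)
  case less
  interpret S: group S using assms(1) by (simp add: free_group_on_def)
  interpret H: group H by fact
  have B: "B \<subseteq> carrier S" using assms(1) by (simp add: free_group_on_def)
  show ?case
  proof (cases "w = []")
    case False
    then have "\<not> reduced_word w"
      using less.prems assms(1) unfolding free_group_on_def by blast
    then obtain u e x v where w: "w = u @ (e, x) # (\<not> e, x) # v"
      using not_reduced_word by blast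
    have "eval_word S (u @ v) = \<one>\<^bsub>S\<^esub>"
      using S.eval_word_cancel[of u e x v] less.prems(2) subset_trans[OF less.prems(1) B]
      unfolding w by metis
    then have "eval_word H (map_word f (u @ v)) = \<one>\<^bsub>H\<^esub>"
      using less.prems(1) w by (intro less.hyps) auto
    moreover have "snd ` set (map_word f w) \<subseteq> carrier H"
      unfolding letters_map_word using less.prems(1) assms(3) by blast
    ultimately show ?thesis
      using H.eval_word_cancel[of "map_word f u" e "f x" "map_word f v"] unfolding w by simp
  qed simp
qed

lemma (in group) generate_eval_word:
  assumes "A \<subseteq> carrier G" "s \<in> generate G A"
  shows "\<exists>w. snd ` set w \<subseteq> A \<and> eval_word G w = s"
  using assms(2)
proof (induction rule: generate.induct)
  case one
  show ?case by (intro exI[of _ "[]"]) simp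
next
  case (incl h)
  then show ?case using assms(1) by (intro exI[of _ "[(True, h)]"]) auto
next
  case (inv h)
  then show ?case using assms(1) by (intro exI[of _ "[(False, h)]"]) auto
next
  case (eng s t)
  then obtain u v where uv: "snd ` set u \<subseteq> A" "eval_word G u = s" "snd ` set v \<subseteq> A" "eval_word G v = t"
    by blast
  have "snd ` set (u @ v) \<subseteq> A" using uv by auto
  moreover from this have "eval_word G (u @ v) = s \<otimes> t"
    using uv(2,4) assms(1) by (subst eval_word_append) auto
  ultimately show ?case by blast
qed

text \<open>The universal property, recovered from the description by reduced words: an element is
  evaluated through any word representing it. Two such words \<open>u\<close> and \<open>v\<close>
  give the relation \<open>inv_word v @ u\<close>, which the preceding lemma transfers to
  \<open>H\<close>.\<close>

lemma free_group_extend: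
  assumes "free_group_on S B" "group H" "f ` B \<subseteq> carrier H"
  shows "\<exists>\<phi>\<in>hom S H. \<forall>x\<in>B. \<phi> x = f x"
proof -
  interpret S: group S using assms(1) by (simp add: free_group_on_def)
  interpret H: group H by fact
  have B: "B \<subseteq> carrier S" "generate S B = carrier S" using assms(1) by (simp_all add: free_group_on_def)
  let ?e = "\<lambda>w. eval_word H (map_word f w)"
  have lettersH: "snd ` set (map_word f w) \<subseteq> carrier H" if "snd ` set w \<subseteq> B" for w
    unfolding letters_map_word using that assms(3) by blast
  have wd: "?e u = ?e v" if uv: "snd ` set u \<subseteq> B" "snd ` set v \<subseteq> B" "eval_word S u = eval_word S v" for u v
  proof -
    have S: "snd ` set u \<subseteq> carrier S" "snd ` set v \<subseteq> carrier S" using uv B by blast+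
    have "eval_word S (inv_word v @ u) = inv\<^bsub>S\<^esub> (eval_word S v) \<otimes>\<^bsub>S\<^esub> eval_word S u"
      using S by (subst S.eval_word_append) (auto simp: S.eval_inv_word image_Un)
    also have "\<dots> = \<one>\<^bsub>S\<^esub>" using uv(3) S.eval_word_closed[OF S(2)] by simp
    finally have "?e (inv_word v @ u) = \<one>\<^bsub>H\<^esub>"
      using uv by (intro free_group_eval_one[OF assms]) (auto simp: image_Un)
    moreover have "?e (inv_word v @ u) = inv\<^bsub>H\<^esub> (?e v) \<otimes>\<^bsub>H\<^esub> ?e u"
      using lettersH[OF uv(1)] lettersH[OF uv(2)]
      by (simp add: H.eval_word_append H.eval_inv_word image_Un)
    moreover have "?e u \<in> carrier H" "?e v \<in> carrier H"
      by (rule H.eval_word_closed[OF lettersH[OF uv(1)]] H.eval_word_closed[OF lettersH[OF uv(2)]])+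
    ultimately have "inv\<^bsub>H\<^esub> (?e u) = inv\<^bsub>H\<^esub> (?e v)"
      using H.inv_equality[of "inv\<^bsub>H\<^esub> (?e v)" "?e u"] H.inv_closed by metis
    then show ?thesis using H.inv_inv[OF \<open>?e u \<in> carrier H\<close>] H.inv_inv[OF \<open>?e v \<in> carrier H\<close>] by metis
  qed
  define word where "word s = (SOME w. snd ` set w \<subseteq> B \<and> eval_word S w = s)" for s
  have word: "snd ` set (word s) \<subseteq> B" "eval_word S (word s) = s" if "s \<in> carrier S" for s
    using someI_ex[OF S.generate_eval_word[OF B(1), of s]] that B(2) unfolding word_def by simp_all
  define \<phi> where "\<phi> s = ?e (word s)" for s
  have \<phi>: "\<phi> (eval_word S w) = ?e w" if "snd ` set w \<subseteq> B" for w
  proof -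
    have "eval_word S w \<in> carrier S" using that B by (intro S.eval_word_closed) blast
    then show ?thesis unfolding \<phi>_def by (intro wd word that)
  qed
  have "\<phi> \<in> hom S H"
  proof (rule homI)
    fix s assume s: "s \<in> carrier S"
    show "\<phi> s \<in> carrier H"
      unfolding \<phi>_def by (rule H.eval_word_closed[OF lettersH[OF word(1)[OF s]]])
    fix t assume t: "t \<in> carrier S"
    have letters: "snd ` set (word s @ word t) \<subseteq> B" using word[OF s] word[OF t] by auto
    have "eval_word S (word s @ word t) = s \<otimes>\<^bsub>S\<^esub> t"
      using S.eval_word_append[OF subset_trans[OF letters B(1)]] word(2)[OF s] word(2)[OF t] by simp
    then have "\<phi> (s \<otimes>\<^bsub>S\<^esub> t) = ?e (word s @ word t)" using \<phi>[OF letters] by metis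
    also have "\<dots> = \<phi> s \<otimes>\<^bsub>H\<^esub> \<phi> t"
      unfolding \<phi>_def map_word_simps using lettersH[OF letters]
      by (intro H.eval_word_append) simp
    finally show "\<phi> (s \<otimes>\<^bsub>S\<^esub> t) = \<phi> s \<otimes>\<^bsub>H\<^esub> \<phi> t" .
  qed
  moreover have "\<phi> x = f x" if "x \<in> B" for x
  proof -
    have "x \<in> carrier S" "f x \<in> carrier H" using that B assms(3) by auto
    then show ?thesis using \<phi>[of "[(True, x)]"] that by simp
  qed
  ultimately show ?thesis by blast
qed

lemma hom_eq_on_generate:
  assumes "group G" "group H" "\<phi> \<in> hom G H" "\<psi> \<in> hom G H" "A \<subseteq> carrier G"
    "\<And>x. x \<in> A \<Longrightarrow> \<phi> x = \<psi> x" "s \<in> generate G A"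
  shows "\<phi> s = \<psi> s"
proof -
  interpret G: group G by fact
  interpret \<phi>: group_hom G H \<phi> using assms by (simp add: group_hom_def group_hom_axioms_def)
  interpret \<psi>: group_hom G H \<psi> using assms by (simp add: group_hom_def group_hom_axioms_def)
  from assms(7) show ?thesis
  proof (induction rule: generate.induct)
    case (inv h)
    then have "h \<in> carrier G" using assms(5) by blast
    then show ?case using assms(6)[OF inv] by simp
  next
    case (eng s t)
    then have "s \<in> carrier G" "t \<in> carrier G"
      using G.generate_in_carrier[OF assms(5)] by blast+
    then show ?case using eng.IH by simp
  qed (use assms(6) in auto)
qed

section \<open>Unitriangular matrices over the integers and residue rings\<close>

text \<open>The integers are the case \<open>q = 0\<close>, as \<open>x mod 0 = x\<close>.\<close>

locale mod_ring = cring R for R :: "(int, 'c) ring_scheme" (structure) +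
  fixes q :: int
  assumes carrier_mod: "x \<in> carrier R \<longleftrightarrow> x mod q = x"
    and add_mod: "x \<oplus> y = (x + y) mod q"
    and mult_mod: "x \<otimes> y = (x * y) mod q"
    and zero_mod: "\<zero> = 0" and one_mod: "\<one> = 1"
begin

lemma one_mod_q [simp]: "1 mod q = 1"
  using one_closed by (simp add: carrier_mod one_mod)

lemma mod_closed [simp]: "x mod q \<in> carrier R"
  by (simp add: carrier_mod)

lemma finsum_mod:
  "finite A \<Longrightarrow> (\<And>k. k \<in> A \<Longrightarrow> f k \<in> carrier R) \<Longrightarrow> finsum R f A = (\<Sum>k\<in>A. f k) mod q"
proof (induction A rule: finite_induct)
  case (insert x A)
  then have "finsum R f (insert x A) = f x \<oplus> finsum R f A" by (intro finsum_insert) auto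
  then show ?case using insert by (simp add: add_mod mod_add_right_eq)
qed (simp add: zero_mod)

definition word_rep :: "nat list \<Rightarrow> ncps \<Rightarrow> nat \<Rightarrow> nat \<Rightarrow> int" where
  "word_rep u f i j = (if i \<le> j \<and> j \<le> length u then nc_coeff f (take (j - i) (drop i u)) mod q else 0)"

text \<open>A splitting of the factor of \<open>u\<close> between positions \<open>i\<close> and
  \<open>j\<close> is a choice of \<open>k\<close> between them, so the Cauchy product at that
  factor is the matrix product at that entry.\<close>

lemma word_rep_mult_entry:
  assumes "i \<le> j" "j \<le> length u"
  shows "(\<Sum>k\<le>length u. word_rep u f i k * word_rep u g k j) mod q = word_rep u (f * g) i j"
proof -
  define w where "w = take (j - i) (drop i u)"
  have len: "length w = j - i" using assms by (simp add: w_def)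
  have "(\<Sum>k\<le>length u. word_rep u f i k * word_rep u g k j)
      = (\<Sum>k\<in>{i..j}. word_rep u f i k * word_rep u g k j)"
    using assms by (intro sum.mono_neutral_right) (auto simp: word_rep_def)
  also have "\<dots> = (\<Sum>l\<in>{0..j - i}. word_rep u f i (l + i) * word_rep u g (l + i) j)"
    using assms(1) sum.shift_bounds_cl_nat_ivl[of "\<lambda>k. word_rep u f i k * word_rep u g k j" 0 i "j - i"]
    by simp
  also have "\<dots> = (\<Sum>l\<in>{0..j - i}. (nc_coeff f (take l w) mod q) * (nc_coeff g (drop l w) mod q))"
  proof (rule sum.cong)
    fix l assume l: "l \<in> {0..j - i}"
    then have "take (l + i - i) (drop i u) = take l w" by (simp add: w_def)
    moreover have "take (j - (l + i)) (drop (l + i) u) = drop l w"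
      by (simp add: w_def drop_take add.commute)
    ultimately show "word_rep u f i (l + i) * word_rep u g (l + i) j
        = (nc_coeff f (take l w) mod q) * (nc_coeff g (drop l w) mod q)"
      using l assms unfolding word_rep_def by simp
  qed simp
  also have "\<dots> mod q = (\<Sum>l\<in>{0..j - i}. nc_coeff f (take l w) * nc_coeff g (drop l w)) mod q"
    by (subst (1 2) mod_sum_eq[symmetric]) (simp add: mod_mult_eq)
  also have "\<dots> = word_rep u (f * g) i j"
    unfolding word_rep_def using assms len by (simp add: nc_coeff_mult w_def[symmetric] atLeast0AtMost)
  finally show ?thesis .
qed

lemma word_rep_hom: "word_rep u \<in> hom nc_units (unitri R (Suc (length u)))"
proof (rule homI)
  fix f assume f: "f \<in> carrier nc_units"
  then show "word_rep u f \<in> carrier (unitri R (Suc (length u)))"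
    using zero_closed by (auto simp: unitri_def word_rep_def one_mod zero_mod)
  fix g assume g: "g \<in> carrier nc_units"
  have "word_rep u (f * g) i j
      = (if i < Suc (length u) \<and> j < Suc (length u)
         then \<Oplus>k\<in>{..<Suc (length u)}. word_rep u f i k \<otimes> word_rep u g k j else \<zero>)" for i j
  proof (cases "i < Suc (length u) \<and> j < Suc (length u)")
    case True
    have "(\<Oplus>k\<in>{..<Suc (length u)}. word_rep u f i k \<otimes> word_rep u g k j)
        = (\<Sum>k\<in>{..<Suc (length u)}. word_rep u f i k \<otimes> word_rep u g k j) mod q"
      by (intro finsum_mod) (auto simp: mult_mod)
    also have "\<dots> = (\<Sum>k\<le>length u. word_rep u f i k * word_rep u g k j) mod q"
      by (simp add: mult_mod mod_sum_eq lessThan_Suc_atMost)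
    also have "\<dots> = word_rep u (f * g) i j"
    proof (cases "i \<le> j")
      case ij: True
      then show ?thesis using word_rep_mult_entry True by simp
    next
      case False
      have "(\<Sum>k\<le>length u. word_rep u f i k * word_rep u g k j) = 0"
        using False by (intro sum.neutral) (auto simp: word_rep_def)
      then show ?thesis using False by (simp add: word_rep_def)
    qed
    finally show ?thesis using True by simp
  next
    case False
    then have "word_rep u (f * g) i j = 0" by (auto simp: word_rep_def)
    then show ?thesis unfolding if_not_P[OF False] zero_mod .
  qed
  then show "word_rep u (f \<otimes>\<^bsub>nc_units\<^esub> g)
      = word_rep u f \<otimes>\<^bsub>unitri R (Suc (length u))\<^esub> word_rep u g"
    by (simp add: unitri_def fun_eq_iff)
qed

lemma word_rep_one: "word_rep u 1 = \<one>\<^bsub>unitri R (Suc (length u))\<^esub>"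
  by (auto simp: unitri_def word_rep_def fun_eq_iff one_mod zero_mod)

text \<open>The letters of \<open>[0..<m]\<close> are distinct, so the factor \<open>[i..<j]\<close>
  is recognized by its first letter \<open>i\<close> and its last letter \<open>j - 1\<close>.
  Different entries above the diagonal thus read different coefficients, which may be prescribed at
  will.\<close>

lemma word_rep_surj:
  assumes "A \<in> carrier (unitri R (Suc m))"
  shows "\<exists>f\<in>carrier nc_units. word_rep [0..<m] f = A"
proof -
  have A: "A i j mod q = A i j" if "i \<le> m" "j \<le> m" for i j
    using assms that by (auto simp: unitri_def carrier_mod)
  have diag: "A i i = 1" if "i \<le> m" for i
    using assms that by (auto simp: unitri_def one_mod)
  have lower: "A i j = 0" if "\<not> (i \<le> j \<and> j \<le> m)" for i j
    using assms that by (auto simp: unitri_def zero_mod not_le not_less) (metis Suc_leI leI le_imp_less_Suc)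
  define f where "f = Abs_ncps (\<lambda>w. if w = [] then 1 else A (hd w) (Suc (last w)))"
  have f: "nc_coeff f w = (if w = [] then 1 else A (hd w) (Suc (last w)))" for w
    by (simp add: f_def Abs_ncps_inverse)
  have "word_rep [0..<m] f i j = A i j" for i j
  proof (cases "i \<le> j \<and> j \<le> m")
    case True
    then have w: "take (j - i) (drop i [0..<m]) = [i..<j]"
      by (simp add: drop_upt take_upt)
    have "nc_coeff f [i..<j] = A i j"
    proof (cases "i = j")
      case False
      then have "[i..<j] \<noteq> []" "hd [i..<j] = i" "last [i..<j] = j - 1" "Suc (j - 1) = j"
        using True by auto
      then show ?thesis by (simp add: f)
    qed (use True diag in \<open>simp add: f\<close>)
    then show ?thesis using True A unfolding word_rep_def w by simp
  next
    case False
    then show ?thesis using lower[OF False] by (auto simp: word_rep_def)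
  qed
  then have "word_rep [0..<m] f = A" by (simp add: fun_eq_iff)
  then show ?thesis using f by (intro bexI[of _ f]) auto
qed

text \<open>The group laws are inherited from the series along a surjective homomorphism, so no
  matrix has to be inverted.\<close>

lemma group_unitri: "group (unitri R (Suc m))"
proof -
  let ?\<pi> = "word_rep [0..<m]"
  have hom: "?\<pi> \<in> hom nc_units (unitri R (Suc m))" using word_rep_hom[of "[0..<m]"] by simp
  have "?\<pi> ` carrier nc_units = carrier (unitri R (Suc m))"
  proof
    show "?\<pi> ` carrier nc_units \<subseteq> carrier (unitri R (Suc m))" using hom by (auto dest: hom_in_carrier)
    show "carrier (unitri R (Suc m)) \<subseteq> ?\<pi> ` carrier nc_units" using word_rep_surj by blast
  qed
  moreover have "?\<pi> \<one>\<^bsub>nc_units\<^esub> = \<one>\<^bsub>unitri R (Suc m)\<^esub>" using word_rep_one[of "[0..<m]"] by simp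
  ultimately show ?thesis
    using ncu.hom_imp_img_group[OF hom] by simp
qed

text \<open>Freeness is what permits the lift: preimages are chosen on the basis only, and both
  homomorphisms agree there.\<close>

lemma unitri_hom_lift:
  assumes "free_group_on S B" "\<rho> \<in> hom S (unitri R (Suc m))"
  shows "\<exists>\<phi>\<in>hom S nc_units. \<forall>s\<in>carrier S. \<rho> s = word_rep [0..<m] (\<phi> s)"
proof -
  have S: "group S" "B \<subseteq> carrier S" "generate S B = carrier S"
    using assms(1) by (simp_all add: free_group_on_def)
  have "\<forall>x\<in>B. \<exists>f. f \<in> carrier nc_units \<and> word_rep [0..<m] f = \<rho> x"
    using word_rep_surj[OF hom_in_carrier[OF assms(2)]] S(2) by blast
  then obtain F where F: "\<forall>x\<in>B. F x \<in> carrier nc_units \<and> word_rep [0..<m] (F x) = \<rho> x"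
    by (rule bchoice[THEN exE])
  then obtain \<phi> where \<phi>: "\<phi> \<in> hom S nc_units" "\<forall>x\<in>B. \<phi> x = F x"
    using free_group_extend[OF assms(1) group_nc_units, of F] by blast
  have hom: "word_rep [0..<m] \<circ> \<phi> \<in> hom S (unitri R (Suc m))"
    using hom_compose[OF \<phi>(1) word_rep_hom[of "[0..<m]"]] by simp
  have "\<rho> x = (word_rep [0..<m] \<circ> \<phi>) x" if "x \<in> B" for x
    using that F \<phi>(2) by simp
  from hom_eq_on_generate[OF S(1) group_unitri assms(2) hom S(2) this]
  have "\<rho> s = (word_rep [0..<m] \<circ> \<phi>) s" if "s \<in> carrier S" for s
    using that S(3) by blast
  then show ?thesis using \<phi>(1) by (intro bexI[of _ \<phi>]) simp_all
qed

lemma hom_kernels_unitri: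
  assumes "free_group_on S B"
  shows "hom_kernels S (unitri R (Suc m)) = {s \<in> carrier S. \<forall>\<phi>\<in>hom S nc_units.
    \<forall>w. 0 < length w \<and> length w \<le> m \<longrightarrow> q dvd nc_coeff (\<phi> s) w}" (is "_ = ?K")
proof (intro equalityI subsetI)
  fix s assume s: "s \<in> hom_kernels S (unitri R (Suc m))"
  have "q dvd nc_coeff (\<phi> s) w" if \<phi>: "\<phi> \<in> hom S nc_units" and w: "0 < length w" "length w \<le> m" for \<phi> w
  proof -
    \<comment> \<open>Padding on the right gives a word of the length that fits the matrix size
      while keeping \<open>w\<close> as a prefix; the entry at row 0 and column
      \<open>length w\<close> then reads the coefficient of \<open>w\<close>.\<close>
    define u where "u = w @ replicate (m - length w) 0"
    have u: "length u = m" "take (length w) u = w" using w by (simp_all add: u_def)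
    have "word_rep u \<circ> \<phi> \<in> hom S (unitri R (Suc m))"
      using hom_compose[OF \<phi> word_rep_hom[of u]] u(1) by simp
    then have "word_rep u (\<phi> s) = \<one>\<^bsub>unitri R (Suc m)\<^esub>"
      using s by (auto simp: hom_kernels_def kernel_def)
    then have "word_rep u (\<phi> s) 0 (length w) = 0"
      using w by (simp add: unitri_def zero_mod)
    then show ?thesis using u w by (simp add: word_rep_def dvd_eq_mod_eq_0)
  qed
  then show "s \<in> ?K" using s by (auto simp: hom_kernels_def)
next
  fix s assume s: "s \<in> ?K"
  have "\<rho> s = \<one>\<^bsub>unitri R (Suc m)\<^esub>" if \<rho>: "\<rho> \<in> hom S (unitri R (Suc m))" for \<rho>
  proof -
    obtain \<phi> where \<phi>: "\<phi> \<in> hom S nc_units" "\<rho> s = word_rep [0..<m] (\<phi> s)"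
      using unitri_hom_lift[OF assms \<rho>] s by blast
    have "nc_coeff (\<phi> s) [] = 1" using hom_in_carrier[OF \<phi>(1), of s] s by simp
    moreover have "nc_coeff (\<phi> s) w mod q = 0" if "0 < length w" "length w \<le> m" for w
      using s \<phi>(1) that by auto
    \<comment> \<open>Entries above the diagonal read words of length between 1 and
      \<open>m\<close>, those on it the empty word.\<close>
    ultimately have "word_rep [0..<m] (\<phi> s) i j = word_rep [0..<m] 1 i j" for i j
      unfolding word_rep_def by (cases "i < j") auto
    then show ?thesis using word_rep_one[of "[0..<m]"] \<phi>(2) by (simp add: fun_eq_iff)
  qed
  then show "s \<in> hom_kernels S (unitri R (Suc m))"
    using s by (auto simp: hom_kernels_def kernel_def)
qed

end

lemma mod_ring_int: "mod_ring \<Z> 0"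
  unfolding mod_ring_def mod_ring_axioms_def using int_is_cring by simp

lemma mod_ring_residue_ring:
  assumes "1 < q"
  shows "mod_ring (residue_ring q) q"
proof -
  have "cring (residue_ring q)"
    using residues.cring[of q] assms by (simp add: residues_def)
  moreover have "x \<in> {0..q - 1} \<longleftrightarrow> x mod q = x" for x
    using assms by (auto simp: mod_pos_pos_trivial) (smt (verit) pos_mod_bound pos_mod_sign)+
  ultimately show ?thesis
    unfolding mod_ring_def mod_ring_axioms_def by (simp add: residue_ring_def)
qed

section \<open>The filtrations induced on the central series\<close>

lemma hom_gcomm:
  assumes "group G" "\<phi> \<in> hom G nc_units" "x \<in> carrier G" "y \<in> carrier G"
  shows "\<phi> (gcomm G x y) = inv\<^bsub>nc_units\<^esub> (\<phi> x) * inv\<^bsub>nc_units\<^esub> (\<phi> y) * \<phi> x * \<phi> y"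
proof -
  interpret \<phi>: group_hom G nc_units \<phi>
    using assms group_nc_units by (simp add: group_hom_def group_hom_axioms_def)
  show ?thesis using assms(3,4) by (simp add: gcomm_def)
qed

lemma hom_generate_mem:
  assumes "group G" "group H" "\<phi> \<in> hom G H" "subgroup K H" "A \<subseteq> carrier G"
    "\<And>x. x \<in> A \<Longrightarrow> \<phi> x \<in> K" "s \<in> generate G A"
  shows "\<phi> s \<in> K"
proof -
  interpret G: group G by fact
  interpret \<phi>: group_hom G H \<phi> using assms by (simp add: group_hom_def group_hom_axioms_def)
  from assms(7) show ?thesis
  proof (induction rule: generate.induct)
    case one
    show ?case using subgroup.one_closed[OF assms(4)] by simp
  next
    case (incl h)
    then show ?case by (rule assms(6))
  next
    case (inv h)
    then have "h \<in> carrier G" using assms(5) by blast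
    then show ?case using subgroup.m_inv_closed[OF assms(4) assms(6)[OF inv]] by simp
  next
    case (eng s t)
    then have "s \<in> carrier G" "t \<in> carrier G"
      using G.generate_in_carrier[OF assms(5)] by blast+
    then show ?case using subgroup.m_closed[OF assms(4) eng.IH] by simp
  qed
qed

section \<open>The descending p-central series\<close>

lemma (in group) p_central_Suc:
  "1 \<le> i \<Longrightarrow> p_central G p (Suc i)
    = generate G (ppowers G p (p_central G p i) \<union> comm_sub G (p_central G p i) (carrier G))"
  by (cases i) auto

lemma (in group) p_central_gen_mem:
  assumes "1 \<le> i" "x \<in> p_central G p i"
  shows "x [^] p \<in> p_central G p (Suc i)"
    and "y \<in> carrier G \<Longrightarrow> gcomm G x y \<in> p_central G p (Suc i)"
proof -
  show "x [^] p \<in> p_central G p (Suc i)"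
    unfolding p_central_Suc[OF assms(1)] ppowers_def using assms(2) by (intro generate.incl) blast
  assume "y \<in> carrier G"
  then show "gcomm G x y \<in> p_central G p (Suc i)"
    unfolding p_central_Suc[OF assms(1)] comm_sub_gcomm using assms(2)
    by (intro generate.incl UnI2) blast
qed

lemma (in group) p_central_gen_carrier:
  assumes "K \<subseteq> carrier G"
  shows "ppowers G p K \<union> comm_sub G K (carrier G) \<subseteq> carrier G"
proof -
  have "{gcomm G x y |x y. x \<in> K \<and> y \<in> carrier G} \<subseteq> carrier G"
    using assms by auto
  then have "comm_sub G K (carrier G) \<subseteq> carrier G"
    unfolding comm_sub_gcomm by (intro generate_subset subgroup_self)
  then show ?thesis using assms by (auto simp: ppowers_def)
qed

lemma (in group) subgroup_nat_pow_mem: "subgroup H G \<Longrightarrow> x \<in> H \<Longrightarrow> x [^] (k :: nat) \<in> H"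
  by (induction k) (auto intro: subgroup.one_closed subgroup.m_closed)

lemma (in group) p_central_normal_chain:
  "p_central G p i \<lhd> G \<and> p_central G p (Suc i) \<subseteq> p_central G p i"
proof (induction i)
  case 0
  show ?case using normal_self by simp
next
  case (Suc i)
  let ?N = "p_central G p (Suc i)"
  have sub: "p_central G p i \<subseteq> carrier G"
    using Suc normal_imp_subgroup subgroup.subset by blast
  have sg: "subgroup ?N G"
  proof (cases "i = 0")
    case False
    then show ?thesis
      using p_central_Suc[of i p] p_central_gen_carrier[OF sub] by (simp add: generate_is_subgroup)
  qed (simp add: subgroup_self)
  have mem: "gcomm G k s \<in> ?N" if "k \<in> ?N" "s \<in> carrier G" for k s
  proof (cases "i = 0")
    case True
    then show ?thesis using that by simp
  next
    case False
    have "k \<in> p_central G p i" using that(1) Suc by blast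
    then show ?thesis using p_central_gen_mem(2)[of i k p s] False that(2) by simp
  qed
  have "x [^] p \<in> ?N" if "x \<in> ?N" for x
    using sg that by (rule subgroup_nat_pow_mem)
  then have "ppowers G p ?N \<subseteq> ?N" by (auto simp: ppowers_def)
  moreover have "comm_sub G ?N (carrier G) \<subseteq> ?N"
    unfolding comm_sub_gcomm by (rule generate_subset[OF sg]) (use mem in blast)
  ultimately have "p_central G p (Suc (Suc i)) \<subseteq> ?N"
    unfolding p_central.simps(3) by (intro generate_subset sg) simp
  then show ?case using normal_if_gcomm_mem[OF sg mem] by blast
qed

lemma (in group) p_central_subgroup: "subgroup (p_central G p i) G"
  by (rule normal_imp_subgroup[OF p_central_normal_chain[THEN conjunct1]])

lemma (in group) p_central_antimono: "i \<le> j \<Longrightarrow> p_central G p j \<subseteq> p_central G p i"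
  by (rule lift_Suc_antimono_le[of "p_central G p", OF p_central_normal_chain[THEN conjunct2]])

lemma (in group) lower_central_le_p_central: "lower_central G i \<subseteq> p_central G p i"
proof (induction i)
  case (Suc i)
  show ?case
  proof (cases "i = 0")
    case False
    then have i: "1 \<le> i" by simp
    show ?thesis
      unfolding lower_central_Suc[OF i] comm_sub_gcomm
      by (rule generate_subset[OF p_central_subgroup])
        (use Suc p_central_gen_mem(2)[OF i] in blast)
  qed simp
qed simp

section \<open>The Zassenhaus filtration\<close>

declare zassenhaus.simps [simp del]

lemma zassenhaus_le_1: "n \<le> 1 \<Longrightarrow> zassenhaus G p n = carrier G"
  by (subst zassenhaus.simps) simp

lemma zassenhaus_generate:
  assumes "2 \<le> n" "2 \<le> p"
  shows "zassenhaus G p n = generate G (ppowers G p (zassenhaus G p ((n + p - 1) div p))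
    \<union> (\<Union>i\<in>{1..<n}. comm_sub G (zassenhaus G p i) (zassenhaus G p (n - i))))"
  using assms by (subst zassenhaus.simps) simp

text \<open>The second bound lets inductions reach the term whose powers are taken; the third says
  that \<open>p\<close>-th powers from that term reach weight \<open>n\<close>.\<close>

lemma ceil_div_bounds:
  fixes n p :: nat
  assumes "2 \<le> p" "2 \<le> n"
  shows "1 \<le> (n + p - 1) div p" "(n + p - 1) div p < n" "n \<le> p * ((n + p - 1) div p)"
proof -
  have "p \<le> n + p - 1" using assms by linarith
  then show "1 \<le> (n + p - 1) div p"
    using assms div_greater_zero_iff[of "n + p - 1" p] by linarith
  obtain k where k: "n = k + 2" using assms(2) by (metis add.commute le_Suc_ex)
  obtain r where r: "p = r + 2" using assms(1) by (metis add.commute le_Suc_ex)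
  have "n + p - 1 < n * p" unfolding k r by (simp add: algebra_simps)
  then show "(n + p - 1) div p < n" using assms(1) by (simp add: div_less_iff_less_mult)
  have "n + p - 1 < p * ((n + p - 1) div p) + p"
    using assms mod_less_divisor[of p "n + p - 1"] mult_div_mod_eq[of p "n + p - 1"] by linarith
  then show "n \<le> p * ((n + p - 1) div p)" by linarith
qed

lemma (in group) zassenhaus_gen_carrier:
  assumes "\<And>i. i < n \<Longrightarrow> zassenhaus G p i \<subseteq> carrier G" "2 \<le> n" "2 \<le> p"
  shows "ppowers G p (zassenhaus G p ((n + p - 1) div p))
    \<union> (\<Union>i\<in>{1..<n}. comm_sub G (zassenhaus G p i) (zassenhaus G p (n - i))) \<subseteq> carrier G"
proof (intro Un_least UN_least)
  show "ppowers G p (zassenhaus G p ((n + p - 1) div p)) \<subseteq> carrier G"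
    using assms(1)[OF ceil_div_bounds(2)[OF assms(3,2)]] by (auto simp: ppowers_def)
  fix i assume i: "i \<in> {1..<n}"
  then have "zassenhaus G p i \<subseteq> carrier G" "zassenhaus G p (n - i) \<subseteq> carrier G"
    by (intro assms(1); simp)+
  then have "{gcomm G x y |x y. x \<in> zassenhaus G p i \<and> y \<in> zassenhaus G p (n - i)} \<subseteq> carrier G"
    by (blast intro: gcomm_closed)
  then show "comm_sub G (zassenhaus G p i) (zassenhaus G p (n - i)) \<subseteq> carrier G"
    unfolding comm_sub_gcomm by (intro generate_subset subgroup_self)
qed

lemma (in group) zassenhaus_subgroup: "2 \<le> p \<Longrightarrow> subgroup (zassenhaus G p n) G"
proof (induction n rule: less_induct)
  case (less n)
  show ?case
  proof (cases "2 \<le> n")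
    case True
    have "zassenhaus G p i \<subseteq> carrier G" if "i < n" for i
      using less.IH[OF that less.prems] by (rule subgroup.subset)
    from zassenhaus_gen_carrier[OF this True less.prems] show ?thesis
      unfolding zassenhaus_generate[OF True less.prems] by (rule generate_is_subgroup)
  qed (simp add: zassenhaus_le_1 subgroup_self)
qed

lemma (in group) zassenhaus_carrier: "2 \<le> p \<Longrightarrow> zassenhaus G p n \<subseteq> carrier G"
  by (rule subgroup.subset[OF zassenhaus_subgroup])

lemma (in group) zassenhaus_gcomm:
  assumes "2 \<le> p" "1 \<le> i" "1 \<le> j" "x \<in> zassenhaus G p i" "y \<in> zassenhaus G p j"
  shows "gcomm G x y \<in> zassenhaus G p (i + j)"
proof -
  have n: "2 \<le> i + j" using assms(2,3) by linarith
  have "gcomm G x y \<in> comm_sub G (zassenhaus G p i) (zassenhaus G p (i + j - i))"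
    unfolding comm_sub_gcomm using assms(4,5) by (intro generate.incl) auto
  moreover have "i \<in> {1..<i + j}" using assms(2,3) by simp
  ultimately show ?thesis
    unfolding zassenhaus_generate[OF n assms(1)] by (intro generate.incl UnI2 UN_I[of i])
qed

text \<open>For positive \<open>i\<close> the rounded quotient of \<open>p * i\<close> by
  \<open>p\<close> is \<open>i\<close> again, so the power is one of the generators. Index 0 denotes
  the whole group.\<close>

lemma (in group) zassenhaus_power:
  assumes "2 \<le> p" "x \<in> zassenhaus G p i"
  shows "x [^] p \<in> zassenhaus G p (p * i)"
proof (cases "1 \<le> i")
  case True
  have "2 * 1 \<le> p * i" by (rule mult_le_mono) (use assms(1) True in auto)
  then have n: "2 \<le> p * i" by simp
  have "(p * i + p - 1) div p = (p - 1 + p * i) div p" using assms(1) by (simp add: add.commute)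
  also have "\<dots> = (p - 1) div p + i" using assms(1) by (subst div_mult_self2) simp_all
  also have "\<dots> = i" using assms(1) by simp
  finally have c: "(p * i + p - 1) div p = i" .
  show ?thesis
    unfolding zassenhaus_generate[OF n assms(1)] c ppowers_def using assms(2)
    by (intro generate.incl UnI1) blast
next
  case False
  then have "i = 0" by simp
  then show ?thesis using assms(2) by (simp add: zassenhaus_le_1)
qed

text \<open>From \<open>n\<close> to \<open>Suc n\<close> the rounded quotient grows by at most one,
  and one of the two commutator indices can be lowered by one: the right one if
  \<open>i = 1\<close>, otherwise the left one. Both indices stay positive, so the generators of the
  term \<open>Suc n\<close> land in the term \<open>n\<close>.\<close>

lemma (in group) zassenhaus_antimono_Suc:
  "2 \<le> p \<Longrightarrow> zassenhaus G p (Suc n) \<subseteq> zassenhaus G p n"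
proof (induction n rule: less_induct)
  case (less n)
  note p = less.prems
  show ?case
  proof (cases "2 \<le> n")
    case False
    then have "n \<le> 1" by simp
    then show ?thesis using zassenhaus_carrier[OF p] by (simp add: zassenhaus_le_1)
  next
    case True
    let ?Z = "zassenhaus G p"
    have n: "2 \<le> Suc n" using True by simp
    define c c' where "c = (n + p - 1) div p" and "c' = (Suc n + p - 1) div p"
    have "c \<le> c'" unfolding c_def c'_def by (intro div_le_mono) simp
    moreover have "c' \<le> Suc c"
    proof -
      have "c' \<le> (n + p - 1 + p) div p" unfolding c'_def using p by (intro div_le_mono) simp
      also have "\<dots> = Suc c" unfolding c_def using p by (subst div_add_self2) simp_all
      finally show ?thesis .
    qed
    ultimately have "c' = c \<or> c' = Suc c" by linarith
    then have "?Z c' \<subseteq> ?Z c"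
      using less.IH[OF _ p, of c] ceil_div_bounds(2)[OF p True] by (auto simp: c_def)
    then have "ppowers G p (?Z c') \<subseteq> ppowers G p (?Z c)" by (auto simp: ppowers_def)
    also have "\<dots> \<subseteq> ?Z n"
      unfolding zassenhaus_generate[OF True p] c_def by (auto intro: generate.incl)
    finally have pow: "ppowers G p (?Z c') \<subseteq> ?Z n" .
    have comm: "comm_sub G (?Z i) (?Z (Suc n - i)) \<subseteq> ?Z n" if i: "i \<in> {1..<Suc n}" for i
      unfolding comm_sub_gcomm
    proof (rule generate_subset[OF zassenhaus_subgroup[OF p]], safe)
      fix x y assume xy: "x \<in> ?Z i" "y \<in> ?Z (Suc n - i)"
      show "gcomm G x y \<in> ?Z n"
      proof (cases "i = 1")
        case True
        have "y \<in> ?Z (n - 1)"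
          using xy(2) less.IH[OF _ p, of "n - 1"] True \<open>2 \<le> n\<close> by auto
        then have "gcomm G x y \<in> ?Z (i + (n - 1))"
          using xy(1) True \<open>2 \<le> n\<close> by (intro zassenhaus_gcomm p) auto
        then show ?thesis using True \<open>2 \<le> n\<close> by simp
      next
        case False
        have "i - 1 < n" "Suc (i - 1) = i" using i unfolding atLeastLessThan_iff by linarith+
        then have "x \<in> ?Z (i - 1)" using xy(1) less.IH[OF _ p, of "i - 1"] by auto
        then have "gcomm G x y \<in> ?Z (i - 1 + (Suc n - i))"
          using xy(2) False i by (intro zassenhaus_gcomm p) auto
        then show ?thesis using False i by simp
      qed
    qed
    show ?thesis
      unfolding zassenhaus_generate[OF n p] c'_def[symmetric]
      by (intro generate_subset[OF zassenhaus_subgroup[OF p]] Un_least UN_least pow comm)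
  qed
qed

lemma (in group) zassenhaus_antimono:
  "2 \<le> p \<Longrightarrow> i \<le> j \<Longrightarrow> zassenhaus G p j \<subseteq> zassenhaus G p i"
  by (rule lift_Suc_antimono_le[of "zassenhaus G p", OF zassenhaus_antimono_Suc])

lemma (in group) lower_central_le_zassenhaus:
  assumes "2 \<le> p"
  shows "lower_central G i \<subseteq> zassenhaus G p i"
proof (induction i)
  case (Suc i)
  show ?case
  proof (cases "i = 0")
    case False
    then have i: "1 \<le> i" by simp
    have "{gcomm G x y |x y. x \<in> lower_central G i \<and> y \<in> carrier G} \<subseteq> zassenhaus G p (i + 1)"
      using Suc zassenhaus_gcomm[OF assms i, of 1] zassenhaus_le_1[of 1 G p] by auto
    then show ?thesis
      unfolding lower_central_Suc[OF i] comm_sub_gcomm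
      using generate_subset[OF zassenhaus_subgroup[OF assms]] by simp
  qed (simp add: zassenhaus_le_1)
qed (simp add: zassenhaus_le_1)

section \<open>Homomorphisms carry the central series into the filtrations\<close>

context nc_filtration
begin

lemma one_units_iff:
  assumes "nc_coeff f [] = 1"
  shows "f \<in> one_units n \<longleftrightarrow> (\<forall>w. 0 < length w \<longrightarrow> d n (length w) dvd nc_coeff f w)"
proof -
  have "(d n (length w) dvd nc_coeff (f - 1) w)
      \<longleftrightarrow> (0 < length w \<longrightarrow> d n (length w) dvd nc_coeff f w)" for w
    using assms by (cases "w = []") auto
  then show ?thesis using assms by (auto simp: one_units_def filt_def)
qed

text \<open>The axiom \<open>d_1\<close> at work: step 1 imposes nothing beyond constant term 1, so
  any homomorphism starts the inductions.\<close>

lemma one_units_1: "f \<in> carrier nc_units \<Longrightarrow> f \<in> one_units 1"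
  using d_1 by (subst one_units_iff) (auto simp: gr0_conv_Suc)

lemma hom_gcomm_one_units:
  assumes "group G" "\<phi> \<in> hom G nc_units" "x \<in> carrier G" "y \<in> carrier G"
    "\<phi> x \<in> one_units i" "\<phi> y \<in> one_units j"
  shows "\<phi> (gcomm G x y) \<in> one_units (i + j)"
  unfolding hom_gcomm[OF assms(1-4)] using assms(5,6) by (rule one_units_commutator)

lemma hom_lower_central:
  assumes "group G" "\<phi> \<in> hom G nc_units" "1 \<le> i"
  shows "x \<in> lower_central G i \<Longrightarrow> \<phi> x \<in> one_units i"
  using assms(3)
proof (induction i arbitrary: x rule: dec_induct)
  case base
  then show ?case using hom_in_carrier[OF assms(2)] by (intro one_units_1) simp
next
  case (step i)
  interpret group G by fact
  have "{gcomm G x y |x y. x \<in> lower_central G i \<and> y \<in> carrier G} \<subseteq> carrier G"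
    using lower_central_carrier by auto
  moreover have "\<phi> z \<in> one_units (Suc i)"
    if "z \<in> {gcomm G x y |x y. x \<in> lower_central G i \<and> y \<in> carrier G}" for z
  proof -
    obtain x y where z: "z = gcomm G x y" "x \<in> lower_central G i" "y \<in> carrier G" using \<open>z \<in> _\<close> by blast
    have "\<phi> y \<in> one_units 1" using hom_in_carrier[OF assms(2) z(3)] by (rule one_units_1)
    then show ?thesis
      using hom_gcomm_one_units[OF assms(1,2) lower_central_carrier[OF z(2)] z(3) step.IH[OF z(2)], of 1] z(1)
      by simp
  qed
  ultimately show ?case
    using step.prems hom_generate_mem[OF assms(1) group_nc_units assms(2) subgroup_one_units]
    unfolding lower_central_Suc[OF step.hyps(1)] comm_sub_gcomm by blast
qed

text \<open>The power contributes \<open>(f - 1) ^ p\<close>, which lies in step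
  \<open>p * i\<close>, and a multiple of \<open>p (f - 1)\<close>. The last two hypotheses send
  these to step \<open>k\<close>, which is \<open>Suc i\<close> for the \<open>p\<close>-central
  series and \<open>n\<close> for the Zassenhaus filtration.\<close>

lemma one_units_prime_pow:
  assumes "Factorial_Ring.prime (p :: nat)" "f \<in> one_units i"
    "\<And>g. g \<in> filt i \<Longrightarrow> of_nat p * g \<in> filt k" "k \<le> p * i"
  shows "f ^ p \<in> one_units k"
proof -
  let ?g = "f - 1"
  obtain h where h: "(1 + ?g) ^ p = 1 + ?g ^ p + of_nat p * (?g * h)"
    using one_plus_power_prime[OF assms(1)] by blast
  have g: "?g \<in> filt i" using assms(2) by (simp add: one_units_def)
  have "?g ^ p + of_nat p * (?g * h) \<in> filt k"
    by (intro filt_add assms(3) filt_mult_right g filt_mono[OF filt_power[OF g] assms(4)])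
  then have "f ^ p - 1 \<in> filt k" using h by simp
  moreover have "f ^ p \<in> carrier nc_units"
    using ncu.nat_pow_closed[of f p] assms(2) by (simp add: one_units_def)
  ultimately show ?thesis by (simp add: one_units_def)
qed

lemma hom_p_central:
  assumes "group G" "\<phi> \<in> hom G nc_units" "1 \<le> i" "Factorial_Ring.prime p"
    "\<And>i a. d (Suc i) a dvd int p * d i a"
  shows "x \<in> p_central G p i \<Longrightarrow> \<phi> x \<in> one_units i"
  using assms(3)
proof (induction i arbitrary: x rule: dec_induct)
  case base
  then show ?case using hom_in_carrier[OF assms(2)] by (intro one_units_1) simp
next
  case (step i)
  interpret group G by fact
  let ?N = "p_central G p i"
  have NG: "z \<in> carrier G" if "z \<in> ?N" for z
    using subgroup.mem_carrier[OF p_central_subgroup that] .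
  have comm: "\<phi> z \<in> one_units (Suc i)" if z: "z \<in> comm_sub G ?N (carrier G)" for z
  proof (rule hom_generate_mem[OF assms(1) group_nc_units assms(2) subgroup_one_units _ _ z[unfolded comm_sub_gcomm]])
    show "{gcomm G x y |x y. x \<in> ?N \<and> y \<in> carrier G} \<subseteq> carrier G" using NG by auto
    fix z assume "z \<in> {gcomm G x y |x y. x \<in> ?N \<and> y \<in> carrier G}"
    then obtain x y where z: "z = gcomm G x y" "x \<in> ?N" "y \<in> carrier G" by blast
    have "\<phi> y \<in> one_units 1" using hom_in_carrier[OF assms(2) z(3)] by (rule one_units_1)
    then show "\<phi> z \<in> one_units (Suc i)"
      using hom_gcomm_one_units[OF assms(1,2) NG[OF z(2)] z(3) step.IH[OF z(2)], of 1] z(1) by simp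
  qed
  have pow: "\<phi> z \<in> one_units (Suc i)" if z: "z \<in> ppowers G p ?N" for z
  proof -
    obtain x where x: "z = x [^]\<^bsub>G\<^esub> p" "x \<in> ?N" using z by (auto simp: ppowers_def)
    have "\<phi> z = \<phi> x ^ p"
      using hom_nat_pow[OF assms(2) NG[OF x(2)] assms(1) group_nc_units, of p] x(1) by simp
    moreover have "\<phi> x ^ p \<in> one_units (Suc i)"
    proof (rule one_units_prime_pow[OF assms(4) step.IH[OF x(2)]])
      show "of_nat p * g \<in> filt (Suc i)" if "g \<in> filt i" for g
        using that assms(5) unfolding filt_def
        by (auto intro: dvd_trans[OF _ mult_dvd_mono[OF dvd_refl]])
      \<comment> \<open>Positivity of \<open>i\<close> matters: \<open>2 * i\<close> reaches
        \<open>Suc i\<close> only from \<open>i = 1\<close> on.\<close>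
      have "2 * i \<le> p * i" using prime_ge_2_nat[OF assms(4)] by (rule mult_le_mono1)
      then show "Suc i \<le> p * i" using step.hyps by linarith
    qed
    ultimately show ?thesis by simp
  qed
  have "ppowers G p ?N \<union> comm_sub G ?N (carrier G) \<subseteq> carrier G"
    using NG by (intro p_central_gen_carrier) blast
  from hom_generate_mem[OF assms(1) group_nc_units assms(2) subgroup_one_units this]
  show ?case using step.prems comm pow unfolding p_central_Suc[OF step.hyps(1)] by blast
qed

lemma hom_zassenhaus:
  assumes "group G" "\<phi> \<in> hom G nc_units" "Factorial_Ring.prime p"
    "\<And>i a. d i a dvd int p"
  shows "x \<in> zassenhaus G p n \<Longrightarrow> \<phi> x \<in> one_units n"
proof (induction n arbitrary: x rule: less_induct)
  case (less n)
  interpret group G by fact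
  have p: "2 \<le> p" using prime_ge_2_nat[OF assms(3)] .
  show ?case
  proof (cases "2 \<le> n")
    case False
    then have "\<phi> x \<in> one_units 1"
      using hom_in_carrier[OF assms(2)] less.prems by (intro one_units_1) (simp add: zassenhaus_le_1)
    then show ?thesis using one_units_mono False by simp
  next
    case True
    let ?Z = "zassenhaus G p" and ?c = "(n + p - 1) div p"
    note ZG = subsetD[OF zassenhaus_carrier[OF p]]
    have comm: "\<phi> z \<in> one_units n" if i: "i \<in> {1..<n}" and z: "z \<in> comm_sub G (?Z i) (?Z (n - i))" for z i
    proof (rule hom_generate_mem[OF assms(1) group_nc_units assms(2) subgroup_one_units _ _ z[unfolded comm_sub_gcomm]])
      show "{gcomm G x y |x y. x \<in> ?Z i \<and> y \<in> ?Z (n - i)} \<subseteq> carrier G" using ZG by auto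
      fix z assume "z \<in> {gcomm G x y |x y. x \<in> ?Z i \<and> y \<in> ?Z (n - i)}"
      then obtain x y where z: "z = gcomm G x y" "x \<in> ?Z i" "y \<in> ?Z (n - i)" by blast
      have "\<phi> x \<in> one_units i" "\<phi> y \<in> one_units (n - i)"
        using i z by (intro less.IH; simp)+
      then have "\<phi> z \<in> one_units (i + (n - i))"
        unfolding z(1) by (rule hom_gcomm_one_units[OF assms(1,2) ZG[OF z(2)] ZG[OF z(3)]])
      then show "\<phi> z \<in> one_units n" using i by simp
    qed
    have pow: "\<phi> z \<in> one_units n" if z: "z \<in> ppowers G p (?Z ?c)" for z
    proof -
      obtain x where x: "z = x [^]\<^bsub>G\<^esub> p" "x \<in> ?Z ?c" using z by (auto simp: ppowers_def)
      have "\<phi> z = \<phi> x ^ p"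
        using hom_nat_pow[OF assms(2) ZG[OF x(2)] assms(1) group_nc_units, of p] x(1) by simp
      moreover have "\<phi> x ^ p \<in> one_units n"
      proof (rule one_units_prime_pow[OF assms(3) less.IH[OF _ x(2)]])
        \<comment> \<open>Every divisor of this filtration divides \<open>p\<close>, so multiples of
          \<open>p\<close> belong to all steps.\<close>
        show "of_nat p * g \<in> filt n" for g
          using assms(4) by (simp add: filt_def dvd_mult2)
      qed (use ceil_div_bounds[OF p True] in auto)
      ultimately show ?thesis by simp
    qed
    have "ppowers G p (?Z ?c) \<union> (\<Union>i\<in>{1..<n}. comm_sub G (?Z i) (?Z (n - i))) \<subseteq> carrier G"
      by (rule zassenhaus_gen_carrier[OF zassenhaus_carrier[OF p] True p])
    from hom_generate_mem[OF assms(1) group_nc_units assms(2) subgroup_one_units this]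
    show ?thesis using less.prems comm pow unfolding zassenhaus_generate[OF True p] by blast
  qed
qed

end

section \<open>The Magnus representation\<close>

definition nc_var :: "nat \<Rightarrow> ncps" where
  "nc_var j = Abs_ncps (\<lambda>w. if w = [j] then 1 else 0)"

lemma nc_coeff_var [simp]: "nc_coeff (nc_var j) w = (if w = [j] then 1 else 0)"
  by (simp add: nc_var_def Abs_ncps_inverse)

lemma leads_var: "leads q (nc_var j) [j] 1"
  by (auto simp: leads_def sl_less_def)

lemma exists_sl_minimal:
  "finite A \<Longrightarrow> A \<noteq> {} \<Longrightarrow> \<exists>x\<in>A. \<forall>y\<in>A. \<not> sl_less (f y) (f x)"
proof (induction A rule: finite_ne_induct)
  case (singleton x)
  show ?case by (simp add: sl_less_def)
next
  case (insert a A)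
  then obtain x where x: "x \<in> A" "\<forall>y\<in>A. \<not> sl_less (f y) (f x)" by blast
  have irrefl: "\<not> sl_less (f a) (f a)" by (simp add: sl_less_def)
  show ?case
  proof (cases "sl_less (f a) (f x)")
    case True
    then have "\<forall>y\<in>insert a A. \<not> sl_less (f y) (f a)"
      using x(2) irrefl sl_less_trans by blast
    then show ?thesis by blast
  next
    case False
    then have "\<forall>y\<in>insert a A. \<not> sl_less (f y) (f x)" using x(2) by blast
    then show ?thesis using x(1) by blast
  qed
qed

lemma (in group) int_pow_nat_mult:
  assumes "x \<in> carrier G"
  shows "x [^] (int k * e) = (x [^] k) [^] (e :: int)"
  using int_pow_pow[OF assms, of "int k" e] unfolding int_pow_int by (rule sym)

locale magnus_group = marked_group +
  fixes \<mu> :: "'a \<Rightarrow> ncps"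
  assumes \<mu>_hom: "\<mu> \<in> hom G nc_units"
    and \<mu>_b: "j < d \<Longrightarrow> \<mu> (b j) = 1 + nc_var j"
begin

sublocale \<mu>: group_hom G nc_units \<mu>
  using \<mu>_hom group_nc_units by (simp add: group_hom_def group_hom_axioms_def is_group)

text \<open>For the standard factorization \<open>u\<close>, \<open>v\<close> of a Lyndon word,
  \<open>u @ v < v < v @ u\<close>, so the commutator leads with \<open>u @ v = w\<close>. The
  coefficient 1 is the same for every \<open>q\<close>.\<close>

lemma leads_br: "lyn w \<Longrightarrow> leads q (\<mu> (br w) - 1) w 1"
proof (induction "length w" arbitrary: w rule: less_induct)
  case less
  show ?case
  proof (cases "length w < 2")
    case True
    then obtain x where w: "w = [x]" using lyn_length[OF less.prems] by (cases w) auto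
    then have "x < d" using less.prems by (simp add: lyn_def)
    then show ?thesis using leads_var[of q x] \<mu>_b w by (simp add: bracket.simps)
  next
    case False
    then have len: "2 \<le> length w" by simp
    let ?u = "std_left w" and ?v = "std_right w"
    note l = std_length[OF len] lyn_std[OF less.prems len] std_append[OF len]
    have "lyndon w" using less.prems by (simp add: lyn_def)
    note uv = std_less[OF len this]
    have "?u @ ?v < ?v"
      using lyndon_append_less[OF _ _ uv] l by (simp add: lyn_def)
    also have "?v < ?v @ ?u" using l by (intro lex_less_append)
    finally have less': "?u @ ?v < ?v @ ?u" .
    have br: "br w = gcomm G (br ?u) (br ?v)" using False by (subst bracket.simps) simp
    have "\<mu> (br ?u) \<in> carrier nc_units" "\<mu> (br ?v) \<in> carrier nc_units"
      using br_closed l \<mu>.hom_closed by blast+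
    then have "leads q (inv\<^bsub>nc_units\<^esub> \<mu> (br ?u) * inv\<^bsub>nc_units\<^esub> \<mu> (br ?v) * \<mu> (br ?u) * \<mu> (br ?v) - 1)
        (?u @ ?v) 1"
      using less.hyps l by (intro leads_units_commutator less') auto
    then show ?thesis
      unfolding br using hom_gcomm[OF is_group \<mu>_hom] br_closed l by simp
  qed
qed

lemma leads_br_int_pow:
  assumes "lyn w"
  shows "leads q (\<mu> (br w [^] (e :: int)) - 1) w e"
proof -
  have "\<mu> (br w [^] e) = \<mu> (br w) [^]\<^bsub>nc_units\<^esub> e"
    using br_closed[OF assms] by (rule \<mu>.hom_int_pow)
  moreover have "w \<noteq> []" using assms by (auto simp: lyn_def)
  ultimately show ?thesis
    using leads_units_int_pow[OF leads_br[OF assms] \<mu>.hom_closed[OF br_closed[OF assms]]] by simp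
qed

text \<open>The two parts of the exponent act differently: the power of \<open>p\<close> repeats the
  leading word, the cofactor \<open>e\<close> only scales its coefficient.\<close>

lemma leads_br_prime_pow:
  assumes "lyn w" "Factorial_Ring.prime p"
  shows "leads (int p) (\<mu> (br w [^] (int (p ^ v) * e)) - 1) (concat (replicate (p ^ v) w)) e"
proof -
  have "br w [^] (int (p ^ v) * e) = (br w [^] (p ^ v)) [^] e"
    by (rule int_pow_nat_mult[OF br_closed[OF assms(1)]])
  then have eq: "\<mu> (br w [^] (int (p ^ v) * e)) = (\<mu> (br w) ^ (p ^ v)) [^]\<^bsub>nc_units\<^esub> e"
    using br_closed[OF assms(1)] by (simp add: \<mu>.hom_int_pow \<mu>.hom_nat_pow)
  have "w \<noteq> []" "p ^ v \<noteq> 0"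
    using assms prime_gt_0_nat[OF assms(2)] by (auto simp: lyn_def)
  then have "concat (replicate (p ^ v) w) \<noteq> []" by simp
  moreover have "\<mu> (br w) ^ (p ^ v) \<in> carrier nc_units"
    using ncu.nat_pow_closed[OF \<mu>.hom_closed[OF br_closed[OF assms(1)]], of "p ^ v"] by simp
  ultimately show ?thesis
    using leads_units_int_pow[OF leads_units_prime_pow[OF assms(2) leads_br[OF assms(1)]], of v e] eq
    by simp
qed

text \<open>Products of two deviations from 1 lie in step \<open>v + v\<close>, which is contained
  in step \<open>Suc v\<close> because \<open>v\<close> is positive; only the sum of the deviations
  survives.\<close>

lemma br_prod_first_order:
  assumes "nc_filtration \<delta>" "1 \<le> v"
    "\<forall>(w, e)\<in>set es. lyn w \<and> \<mu> (br w [^] e) \<in> nc_filtration.one_units \<delta> v"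
  shows "\<mu> (br_prod es) \<in> nc_filtration.one_units \<delta> v
    \<and> \<mu> (br_prod es) - 1 - (\<Sum>(w, e)\<leftarrow>es. \<mu> (br w [^] e) - 1) \<in> nc_filtration.filt \<delta> (Suc v)"
proof -
  interpret nc_filtration \<delta> by fact
  show ?thesis
    using assms(3)
  proof (induction es)
    case Nil
    then show ?case using subgroup.one_closed[OF subgroup_one_units] by simp
  next
    case (Cons a es)
    obtain w e where a: "a = (w, e)" by (cases a)
    let ?f = "\<mu> (br w [^] e)" and ?g = "\<mu> (br_prod es)" and ?s = "\<Sum>(w, e)\<leftarrow>es. \<mu> (br w [^] e) - 1"
    have f: "?f \<in> one_units v" "lyn w" and es: "\<forall>(w, e)\<in>set es. lyn w \<and> \<mu> (br w [^] e) \<in> one_units v"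
      using Cons.prems a by auto
    from Cons.IH[OF es] have g: "?g \<in> one_units v" "?g - 1 - ?s \<in> filt (Suc v)" by auto
    have prod: "\<mu> (br_prod (a # es)) = ?f * ?g"
      using f(2) es a by (subst \<mu>.hom_mult[symmetric, simplified]) (auto simp: br_closed intro!: br_prod_closed)
    have "(?f - 1) * (?g - 1) \<in> filt (v + v)"
      using f(1) g(1) by (intro filt_mult) (auto simp: one_units_def)
    then have "(?f - 1) * (?g - 1) \<in> filt (Suc v)" by (rule filt_mono) (use assms(2) in simp)
    from filt_add[OF this g(2)]
    have "?f * ?g - 1 - ((?f - 1) + ?s) \<in> filt (Suc v)" by (simp add: algebra_simps)
    then show ?case
      using subgroup.m_closed[OF subgroup_one_units f(1) g(1)] a unfolding prod by simp
  qed
qed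

text \<open>In the normal form of \<open>s\<close>, consider the factors of least value \<open>v < n\<close>, and among these the one with
  least leading word \<open>x\<close>: it is the only factor contributing to the coefficient of \<open>x\<close> modulo
  \<open>\<delta> (Suc v) (length x)\<close>.\<close>

lemma mem_series_if_one_units:
  fixes Y :: "nat \<Rightarrow> 'a set" and val :: "nat list \<Rightarrow> int \<Rightarrow> nat" and lead :: "nat list \<Rightarrow> int \<Rightarrow> nat list"
  assumes "nc_filtration \<delta>" "1 \<le> n" "subgroup (Y n) G"
    and Y_antimono: "\<And>i j. i \<le> j \<Longrightarrow> Y j \<subseteq> Y i"
    and Y_one_units: "\<And>i x. 1 \<le> i \<Longrightarrow> x \<in> Y i \<Longrightarrow> \<mu> x \<in> nc_filtration.one_units \<delta> i"
    and lower_central_Y: "\<gamma> n \<subseteq> Y n"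
    and val: "\<And>w e. lyn w \<Longrightarrow> e \<noteq> 0 \<Longrightarrow> 1 \<le> val w e \<and> br w [^] e \<in> Y (val w e)"
    and lead: "\<And>w e. lyn w \<Longrightarrow> e \<noteq> 0 \<Longrightarrow>
      \<not> \<delta> (Suc (val w e)) (length (lead w e)) dvd nc_coeff (\<mu> (br w [^] e) - 1) (lead w e)"
    and below_lead: "\<And>w e x. lyn w \<Longrightarrow> e \<noteq> 0 \<Longrightarrow> sl_less x (lead w e) \<Longrightarrow>
      \<delta> (Suc (val w e)) (length x) dvd nc_coeff (\<mu> (br w [^] e) - 1) x"
    and lead_inj: "\<And>w e w' e'. lyn w \<Longrightarrow> lyn w' \<Longrightarrow> e \<noteq> 0 \<Longrightarrow> e' \<noteq> 0 \<Longrightarrow>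
      val w e = val w' e' \<Longrightarrow> lead w e = lead w' e' \<Longrightarrow> w = w'"
    and s: "s \<in> carrier G" "\<mu> s \<in> nc_filtration.one_units \<delta> n"
  shows "s \<in> Y n"
proof -
  interpret nc_filtration \<delta> by fact
  have n: "Suc (n - 1) = n" using assms(2) by simp
  \<comment> \<open>Words up to length \<open>n - 1\<close> leave a remainder in the
    \<open>n\<close>-th lower central term, which is already inside \<open>Y n\<close>.\<close>
  obtain es g where es: "distinct (map fst es)" "\<forall>(w, e)\<in>set es. lyn w \<and> length w \<le> n - 1 \<and> e \<noteq> 0"
    "g \<in> \<gamma> n" "s = br_prod es \<otimes> g"
    using lyndon_normal_form[OF s(1), of "n - 1"] unfolding n by blast
  have lyn_es: "\<forall>(w, e)\<in>set es. lyn w" using es(2) by auto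
  have closed: "br_prod es \<in> carrier G" "g \<in> carrier G"
    using lyn_es lower_central_carrier[OF es(3)] by (auto intro: br_prod_closed)
  have val_ge: "n \<le> val w e" if we: "(w, e) \<in> set es" for w e
  proof (rule ccontr)
    assume "\<not> n \<le> val w e"
    define v where "v = Min ((\<lambda>(w, e). val w e) ` set es)"
    have v_le: "v \<le> val w e" if "(w, e) \<in> set es" for w e
      unfolding v_def using that by (intro Min_le) force+
    have "v \<in> (\<lambda>(w, e). val w e) ` set es"
      unfolding v_def using we by (intro Min_in) auto
    then obtain w1 e1 where w1: "(w1, e1) \<in> set es" "val w1 e1 = v" by auto
    have "v < n" using v_le[OF we] \<open>\<not> n \<le> val w e\<close> by simp
    have v1: "1 \<le> v" using val[of w1 e1] w1 es(2) by auto
    define E where "E = {(w, e) \<in> set es. val w e = v}"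
    have "finite E" unfolding E_def by (rule finite_subset[of _ "set es"]) auto
    moreover have "E \<noteq> {}" using w1 by (auto simp: E_def)
    ultimately obtain a where a: "a \<in> E"
      "\<forall>y\<in>E. \<not> sl_less (lead (fst y) (snd y)) (lead (fst a) (snd a))"
      using exists_sl_minimal[of E "\<lambda>y. lead (fst y) (snd y)"] by blast
    obtain w0 e0 where a_eq: "a = (w0, e0)" by (cases a)
    define x where "x = lead w0 e0"
    have a0: "(w0, e0) \<in> set es" "val w0 e0 = v" "lyn w0" "e0 \<noteq> 0"
      using a(1) a_eq es(2) by (auto simp: E_def)
    let ?h = "\<lambda>(w, e). \<mu> (br w [^] e) - 1"
    have units: "\<forall>(w, e)\<in>set es. lyn w \<and> \<mu> (br w [^] e) \<in> one_units v"
    proof (intro ballI, clarify)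
      fix w e assume we: "(w, e) \<in> set es"
      then have "lyn w" "e \<noteq> 0" using es(2) by auto
      then show "lyn w \<and> \<mu> (br w [^] e) \<in> one_units v"
        using val Y_one_units one_units_mono[OF _ v_le[OF we]] by blast
    qed
    \<comment> \<open>The remainder is removed, so that the condition on \<open>s\<close> becomes
      one on the product of brackets alone.\<close>
    have "\<mu> g \<in> one_units n" using Y_one_units[OF assms(2)] lower_central_Y es(3) by blast
    moreover have "\<mu> (br_prod es) = \<mu> s \<otimes>\<^bsub>nc_units\<^esub> inv\<^bsub>nc_units\<^esub> \<mu> g"
    proof -
      have "br_prod es = s \<otimes> inv g" using closed es(4) by (simp add: m_assoc)
      then show ?thesis using closed s(1) \<mu>.hom_mult \<mu>.hom_inv by (metis inv_closed)
    qed
    ultimately have "\<mu> (br_prod es) \<in> one_units n"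
      using subgroup.m_closed[OF subgroup_one_units s(2) subgroup.m_inv_closed[OF subgroup_one_units]]
      by simp
    then have "\<mu> (br_prod es) - 1 \<in> filt (Suc v)"
      using one_units_mono[of _ n "Suc v"] \<open>v < n\<close> by (simp add: one_units_def)
    from filt_diff[OF this conjunct2[OF br_prod_first_order[OF assms(1) v1 units]]]
    have "sum_list (map ?h es) \<in> filt (Suc v)" by simp
    moreover have "distinct es" using es(1) by (simp add: distinct_map)
    ultimately have "sum ?h (set es) \<in> filt (Suc v)" by (simp add: sum_list_distinct_conv_sum_set)
    then have "\<delta> (Suc v) (length x) dvd nc_coeff (sum ?h (set es)) x" by (simp add: filt_def)
    also have "nc_coeff (sum ?h (set es)) x
        = nc_coeff (?h (w0, e0)) x + (\<Sum>y\<in>set es - {(w0, e0)}. nc_coeff (?h y) x)"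
      unfolding nc_coeff_sum using a0(1) by (intro sum.remove) auto
    finally have total: "\<delta> (Suc v) (length x) dvd
        nc_coeff (?h (w0, e0)) x + (\<Sum>y\<in>set es - {(w0, e0)}. nc_coeff (?h y) x)" .
    \<comment> \<open>Another factor of value \<open>v\<close> has a larger leading word, since
      equal leading words would force equal words and these are distinct; a factor of larger value
      already lies in step \<open>Suc v\<close>.\<close>
    have "\<delta> (Suc v) (length x) dvd (\<Sum>y\<in>set es - {(w0, e0)}. nc_coeff (?h y) x)"
    proof (rule dvd_sum)
      fix y assume y: "y \<in> set es - {(w0, e0)}"
      obtain w e where y_eq: "y = (w, e)" by (cases y)
      have we: "(w, e) \<in> set es" "(w, e) \<noteq> (w0, e0)" "lyn w" "e \<noteq> 0" using y y_eq es(2) by auto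
      show "\<delta> (Suc v) (length x) dvd nc_coeff (?h y) x"
      proof (cases "val w e = v")
        case True
        then have E: "(w, e) \<in> E" using we(1) by (simp add: E_def)
        have "w \<noteq> w0" using es(1) we(1,2) a0(1) by (metis eq_key_imp_eq_value)
        then have "lead w e \<noteq> x" using lead_inj[of w w0 e e0] we a0 True by (auto simp: x_def)
        moreover have "\<not> sl_less (lead w e) x" using a(2) E a_eq by (auto simp: x_def)
        ultimately have "sl_less x (lead w e)" using sl_linear by blast
        then show ?thesis using below_lead[OF we(3,4)] True y_eq by simp
      next
        case False
        then have "Suc v \<le> val w e" using v_le[OF we(1)] by simp
        moreover have "\<mu> (br w [^] e) \<in> one_units (val w e)"
          using val[OF we(3,4)] Y_one_units by blast
        ultimately have "\<mu> (br w [^] e) \<in> one_units (Suc v)" by (metis one_units_mono)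
        then show ?thesis by (simp add: one_units_def filt_def y_eq)
      qed
    qed
    then have "\<delta> (Suc v) (length x) dvd nc_coeff (?h (w0, e0)) x"
      using total by (simp add: dvd_add_left_iff)
    then show False using lead[OF a0(3,4)] a0(2) by (simp add: x_def)
  qed
  \<comment> \<open>No factor has value below \<open>n\<close>, so each of them lies in
    \<open>Y n\<close>, and so does their product.\<close>
  have "\<forall>(w, e)\<in>set es. br w [^] e \<in> Y n"
  proof (intro ballI, clarify)
    fix w e assume we: "(w, e) \<in> set es"
    then have "lyn w" "e \<noteq> 0" using es(2) by auto
    then show "br w [^] e \<in> Y n" using val Y_antimono[OF val_ge[OF we]] by blast
  qed
  then have "br_prod es \<in> Y n"
    by (induction es) (auto intro: subgroup.one_closed[OF assms(3)] subgroup.m_closed[OF assms(3)])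
  then show ?thesis
    unfolding es(4) using lower_central_Y es(3) by (intro subgroup.m_closed[OF assms(3)]) auto
qed

end

section \<open>The three choices of divisors\<close>

definition lc_weight :: "nat \<Rightarrow> nat \<Rightarrow> int" where
  "lc_weight i a = (if a < i then 0 else 1)"

definition pc_weight :: "nat \<Rightarrow> nat \<Rightarrow> nat \<Rightarrow> int" where
  "pc_weight p i a = int p ^ (i - a)"

definition zh_weight :: "nat \<Rightarrow> nat \<Rightarrow> nat \<Rightarrow> int" where
  "zh_weight p i a = (if a < i then int p else 1)"

text \<open>Divisor 0 demands a vanishing coefficient. Multiplicativity holds since
  \<open>a + b < i + j\<close> forces \<open>a < i\<close> or \<open>b < j\<close>.\<close>

lemma nc_filtration_lc: "nc_filtration lc_weight"
  by unfold_locales (auto simp: lc_weight_def)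

text \<open>Truncated subtraction is subadditive in the required sense:
  \<open>(i + j) - (a + b)\<close> is at most \<open>(i - a) + (j - b)\<close>.\<close>

lemma nc_filtration_pc: "nc_filtration (pc_weight p)"
  by unfold_locales (auto simp: pc_weight_def simp flip: power_add intro!: le_imp_power_dvd)

lemma nc_filtration_zh: "nc_filtration (zh_weight p)"
  by unfold_locales (auto simp: zh_weight_def)

lemma pc_weight_Suc_dvd: "pc_weight p (Suc i) a dvd int p * pc_weight p i a"
proof -
  have "int p ^ (Suc i - a) dvd int p ^ Suc (i - a)" by (intro le_imp_power_dvd) linarith
  then show ?thesis by (simp add: pc_weight_def)
qed

context magnus_group
begin

text \<open>Here the exponent does not affect the value: the coefficient at \<open>w\<close> is
  \<open>e\<close> itself, and 0 divides it only if it vanishes.\<close>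

lemma lower_central_if_one_units:
  assumes "1 \<le> n" "s \<in> carrier G" "\<mu> s \<in> nc_filtration.one_units lc_weight n"
  shows "s \<in> \<gamma> n"
proof (rule mem_series_if_one_units[where Y = "lower_central G" and \<delta> = lc_weight
      and val = "\<lambda>w _. length w" and lead = "\<lambda>w _. w",
      OF nc_filtration_lc assms(1) lower_central_subgroup lower_central_antimono _ order_refl
      _ _ _ _ assms(2,3)])
  show "\<mu> x \<in> nc_filtration.one_units lc_weight i" if "1 \<le> i" "x \<in> \<gamma> i" for i x
    using nc_filtration.hom_lower_central[OF nc_filtration_lc is_group \<mu>_hom that] .
  fix w :: "nat list" and e :: int assume w: "lyn w" "e \<noteq> 0"
  have L: "leads 0 (\<mu> (br w [^] e) - 1) w e" by (rule leads_br_int_pow[OF w(1)])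
  show "1 \<le> length w \<and> br w [^] e \<in> \<gamma> (length w)"
    using lyn_length[OF w(1)] subgroup_int_pow_closed[OF lower_central_subgroup br_mem[OF w(1)]] by blast
  show "\<not> lc_weight (Suc (length w)) (length w) dvd nc_coeff (\<mu> (br w [^] e) - 1) w"
    using L w(2) unfolding leads_def lc_weight_def by simp
  show "lc_weight (Suc (length w)) (length x) dvd nc_coeff (\<mu> (br w [^] e) - 1) x"
    if "sl_less x w" for x
    using L that unfolding leads_def by simp
qed simp_all

text \<open>The bracket contributes \<open>length w\<close> to the value and each factor
  \<open>p\<close> of the exponent one more. The leading word remains \<open>w\<close>, since over
  the integers its coefficient \<open>e\<close> is nonzero and its divisibility by \<open>p\<close>
  is what the filtration measures.\<close>

lemma p_central_if_one_units:
  assumes p: "Factorial_Ring.prime p" and "1 \<le> n" "s \<in> carrier G"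
    "\<mu> s \<in> nc_filtration.one_units (pc_weight p) n"
  shows "s \<in> p_central G p n"
proof (rule mem_series_if_one_units[where Y = "p_central G p" and \<delta> = "pc_weight p" and lead = "\<lambda>w _. w"
      and val = "\<lambda>w e. length w + multiplicity (int p) e",
      OF nc_filtration_pc assms(2) p_central_subgroup p_central_antimono _ lower_central_le_p_central
      _ _ _ _ assms(3,4)])
  show "\<mu> x \<in> nc_filtration.one_units (pc_weight p) i" if "1 \<le> i" "x \<in> p_central G p i" for i x
    using nc_filtration.hom_p_central[OF nc_filtration_pc is_group \<mu>_hom that(1) p
        pc_weight_Suc_dvd that(2)] .
  fix w :: "nat list" and e :: int assume w: "lyn w" "e \<noteq> 0"
  let ?v = "multiplicity (int p) e"
  have L: "leads 0 (\<mu> (br w [^] e) - 1) w e" by (rule leads_br_int_pow[OF w(1)])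
  have pow: "br w [^] (p ^ v) \<in> p_central G p (length w + v)" for v
  proof (induction v)
    case 0
    show ?case using br_mem[OF w(1)] lower_central_le_p_central br_closed[OF w(1)] by auto
  next
    case (Suc v)
    have "1 \<le> length w + v" using lyn_length[OF w(1)] by simp
    from p_central_gen_mem(1)[OF this Suc]
    show ?case using br_closed[OF w(1)] by (simp add: nat_pow_pow mult.commute)
  qed
  obtain e' where e': "e = int (p ^ ?v) * e'"
    using multiplicity_dvd[of "int p" e] by (auto elim!: dvdE)
  have "br w [^] (int (p ^ ?v) * e') = (br w [^] (p ^ ?v)) [^] e'"
    by (rule int_pow_nat_mult[OF br_closed[OF w(1)]])
  then have "br w [^] e = (br w [^] (p ^ ?v)) [^] e'" using e' by metis
  then show "1 \<le> length w + ?v \<and> br w [^] e \<in> p_central G p (length w + ?v)"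
    using lyn_length[OF w(1)] subgroup_int_pow_closed[OF p_central_subgroup pow[of ?v], of e'] by simp
  have "\<not> is_unit (int p)" using prime_gt_1_nat[OF p] by simp
  then have "\<not> int p ^ Suc ?v dvd e"
    by (subst power_dvd_iff_le_multiplicity[OF w(2)]) simp_all
  \<comment> \<open>The demanded divisor is \<open>p\<close> to the power \<open>Suc ?v\<close>, as
    \<open>length w\<close> cancels, and the coefficient is exactly \<open>e\<close>.\<close>
  then show "\<not> pc_weight p (Suc (length w + ?v)) (length w) dvd nc_coeff (\<mu> (br w [^] e) - 1) w"
    using L unfolding leads_def pc_weight_def by (simp add: Suc_diff_le)
  show "pc_weight p (Suc (length w + ?v)) (length x) dvd nc_coeff (\<mu> (br w [^] e) - 1) x"
    if "sl_less x w" for x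
    using L that unfolding leads_def by simp
qed simp_all

text \<open>Only divisibility by \<open>p\<close> is visible here, so the leading word is taken
  modulo \<open>p\<close> and is \<open>w\<close> repeated \<open>p ^ v\<close> times. Its length
  equals the value, hence the next step just begins to demand divisibility there.\<close>

lemma zassenhaus_if_one_units:
  assumes p: "Factorial_Ring.prime p" and "1 \<le> n" "s \<in> carrier G"
    "\<mu> s \<in> nc_filtration.one_units (zh_weight p) n"
  shows "s \<in> zassenhaus G p n"
proof -
  have p2: "2 \<le> p" using prime_ge_2_nat[OF p] .
  let ?v = "multiplicity (int p)"
  show ?thesis
  proof (rule mem_series_if_one_units[where Y = "zassenhaus G p" and \<delta> = "zh_weight p"
      and lead = "\<lambda>w e. concat (replicate (p ^ ?v e) w)" and val = "\<lambda>w e. p ^ ?v e * length w",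
      OF nc_filtration_zh assms(2) zassenhaus_subgroup[OF p2] zassenhaus_antimono[OF p2] _
      lower_central_le_zassenhaus[OF p2] _ _ _ _ assms(3,4)])
    have "zh_weight p i a dvd int p" for i a by (simp add: zh_weight_def)
    then show "\<mu> x \<in> nc_filtration.one_units (zh_weight p) i" if "x \<in> zassenhaus G p i" for i x
      using nc_filtration.hom_zassenhaus[OF nc_filtration_zh is_group \<mu>_hom p _ that] by blast
    fix w :: "nat list" and e :: int assume w: "lyn w" "e \<noteq> 0"
    have pow: "br w [^] (p ^ v) \<in> zassenhaus G p (p ^ v * length w)" for v
    proof (induction v)
      case 0
      show ?case using br_mem[OF w(1)] lower_central_le_zassenhaus[OF p2] br_closed[OF w(1)] by auto
    next
      case (Suc v)
      from zassenhaus_power[OF p2 Suc]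
      show ?case using br_closed[OF w(1)] by (simp add: nat_pow_pow ac_simps)
    qed
    obtain e' where e': "e = int (p ^ ?v e) * e'"
      using multiplicity_dvd[of "int p" e] by (auto elim!: dvdE)
    have "br w [^] (int (p ^ ?v e) * e') = (br w [^] (p ^ ?v e)) [^] e'"
      by (rule int_pow_nat_mult[OF br_closed[OF w(1)]])
    then have "br w [^] e = (br w [^] (p ^ ?v e)) [^] e'" using e' by metis
    then have "br w [^] e \<in> zassenhaus G p (p ^ ?v e * length w)"
      using subgroup_int_pow_closed[OF zassenhaus_subgroup[OF p2] pow[of "?v e"], of e'] by simp
    moreover have "1 \<le> p ^ ?v e * length w" using lyn_length[OF w(1)] p2 by (simp add: Suc_le_eq)
    ultimately show "1 \<le> p ^ ?v e * length w \<and> br w [^] e \<in> zassenhaus G p (p ^ ?v e * length w)"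
      by blast
    have "leads (int p) (\<mu> (br w [^] (int (p ^ ?v e) * e')) - 1) (concat (replicate (p ^ ?v e) w)) e'"
      by (rule leads_br_prime_pow[OF w(1) p])
    then have L: "leads (int p) (\<mu> (br w [^] e) - 1) (concat (replicate (p ^ ?v e) w)) e'"
      using e' by metis
    have len: "length (concat (replicate (p ^ ?v e) w)) = p ^ ?v e * length w"
      by (simp add: length_concat sum_list_replicate)
    have "\<not> is_unit (int p)" using p2 by simp
    then have "\<not> int p ^ Suc (?v e) dvd e"
      by (subst power_dvd_iff_le_multiplicity[OF w(2)]) simp_all
    \<comment> \<open>The cofactor of the full power of \<open>p\<close> in \<open>e\<close> is
      prime to \<open>p\<close>; otherwise the multiplicity would be larger.\<close>
    moreover have "int p ^ Suc (?v e) dvd e" if "int p dvd e'"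
    proof -
      have "int p ^ ?v e * int p dvd int p ^ ?v e * e'" using that by (intro mult_dvd_mono) auto
      then show ?thesis using e' by (metis of_nat_power power_Suc2)
    qed
    ultimately have "\<not> int p dvd e'" by blast
    then have "\<not> int p dvd nc_coeff (\<mu> (br w [^] e) - 1) (concat (replicate (p ^ ?v e) w))"
      using L unfolding leads_def by (metis dvd_diff_right_iff diff_add_cancel dvd_add_right_iff)
    then show "\<not> zh_weight p (Suc (p ^ ?v e * length w)) (length (concat (replicate (p ^ ?v e) w)))
        dvd nc_coeff (\<mu> (br w [^] e) - 1) (concat (replicate (p ^ ?v e) w))"
      unfolding len zh_weight_def by simp
    show "zh_weight p (Suc (p ^ ?v e * length w)) (length x) dvd nc_coeff (\<mu> (br w [^] e) - 1) x"
      if "sl_less x (concat (replicate (p ^ ?v e) w))" for x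
      using L that unfolding leads_def zh_weight_def by simp
    fix w' :: "nat list" and e'' :: int
    assume w': "lyn w'" "e'' \<noteq> 0" "p ^ ?v e * length w = p ^ ?v e'' * length w'"
      "concat (replicate (p ^ ?v e) w) = concat (replicate (p ^ ?v e'') w')"
    show "w = w'"
    \<comment> \<open>Both repetition counts are powers of \<open>p\<close>, so one divides the
      other.\<close>
    proof (rule lyndon_power_inj[OF _ _ w'(4)])
      show "p ^ ?v e dvd p ^ ?v e'' \<or> p ^ ?v e'' dvd p ^ ?v e"
        using le_imp_power_dvd nat_le_linear by metis
    qed (use w w' p2 in \<open>simp_all add: lyn_def mult.commute\<close>)
  qed
qed

end

section \<open>From coefficient conditions to the intersections of kernels\<close>

lemma free_group_magnus:
  assumes "finite B" "free_group_on S B"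
  shows "\<exists>b d \<mu>. magnus_group S b d \<mu>"
proof -
  obtain b where b: "bij_betw b {0..<card B} B" using ex_bij_betw_nat_finite[OF assms(1)] by blast
  have S: "group S" "B \<subseteq> carrier S" "generate S B = carrier S"
    using assms(2) by (simp_all add: free_group_on_def)
  define f where "f x = 1 + nc_var (inv_into {0..<card B} b x)" for x
  have "f ` B \<subseteq> carrier nc_units" by (auto simp: f_def)
  then obtain \<mu> where \<mu>: "\<mu> \<in> hom S nc_units" "\<forall>x\<in>B. \<mu> x = f x"
    using free_group_extend[OF assms(2) group_nc_units] by blast
  have bB: "b j \<in> B" if "j < card B" for j using b that by (auto simp: bij_betw_def)
  have "b ` {..<card B} = B" using b by (simp add: bij_betw_def atLeast0LessThan)
  moreover have "\<mu> (b j) = 1 + nc_var j" if "j < card B" for j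
    using \<mu>(2) bB[OF that] b that by (auto simp: f_def bij_betw_def)
  ultimately have "magnus_group S b (card B) \<mu>"
    unfolding magnus_group_def magnus_group_axioms_def marked_group_def marked_group_axioms_def
    using S \<mu>(1) bB by auto
  then show ?thesis by blast
qed

text \<open>Matrices of size \<open>n\<close> read words of length at most \<open>n - 1\<close>,
  which are exactly the lengths on which step \<open>n\<close> imposes a condition. One inclusion
  holds for every homomorphism to the units, the other evaluates the condition at
  \<open>\<mu>\<close>.\<close>

lemma hom_kernels_lower_central:
  assumes "finite B" "free_group_on S B" "1 \<le> n"
  shows "lower_central S n = hom_kernels S (unitri \<Z> n)"
proof -
  obtain b d \<mu> where M: "magnus_group S b d \<mu>" using free_group_magnus[OF assms(1,2)] by blast
  interpret magnus_group S b d \<mu> by (rule M)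
  interpret nc_filtration lc_weight by (rule nc_filtration_lc)
  have n: "n = Suc (n - 1)" using assms(3) by simp
  have units: "\<phi> s \<in> one_units n \<longleftrightarrow> (\<forall>w. 0 < length w \<and> length w \<le> n - 1 \<longrightarrow> 0 dvd nc_coeff (\<phi> s) w)"
    if "\<phi> \<in> hom S nc_units" "s \<in> carrier S" for \<phi> s
    using one_units_iff[of "\<phi> s" n] hom_in_carrier[OF that] assms(3) by (auto simp: lc_weight_def)
  have "hom_kernels S (unitri \<Z> n) = {s \<in> carrier S. \<forall>\<phi>\<in>hom S nc_units. \<phi> s \<in> one_units n}"
    using mod_ring.hom_kernels_unitri[OF mod_ring_int assms(2), of "n - 1"] units n by auto
  then show ?thesis
    using lower_central_if_one_units[OF assms(3)] lower_central_carrier \<mu>_hom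
      hom_lower_central[OF is_group _ assms(3)] by blast
qed

lemma hom_kernels_zassenhaus:
  assumes "finite B" "free_group_on S B" "1 \<le> n" and p: "Factorial_Ring.prime p"
  shows "zassenhaus S p n = hom_kernels S (unitri (residue_ring (int p)) n)"
proof -
  obtain b d \<mu> where M: "magnus_group S b d \<mu>" using free_group_magnus[OF assms(1,2)] by blast
  interpret magnus_group S b d \<mu> by (rule M)
  interpret nc_filtration "zh_weight p" by (rule nc_filtration_zh)
  have n: "n = Suc (n - 1)" using assms(3) by simp
  have ring: "mod_ring (residue_ring (int p)) (int p)"
    using prime_gt_1_nat[OF p] by (intro mod_ring_residue_ring) simp
  have units: "\<phi> s \<in> one_units n \<longleftrightarrow> (\<forall>w. 0 < length w \<and> length w \<le> n - 1 \<longrightarrow> int p dvd nc_coeff (\<phi> s) w)"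
    if "\<phi> \<in> hom S nc_units" "s \<in> carrier S" for \<phi> s
    using one_units_iff[of "\<phi> s" n] hom_in_carrier[OF that] assms(3) by (auto simp: zh_weight_def)
  have weight: "zh_weight p i a dvd int p" for i a by (simp add: zh_weight_def)
  have "hom_kernels S (unitri (residue_ring (int p)) n)
      = {s \<in> carrier S. \<forall>\<phi>\<in>hom S nc_units. \<phi> s \<in> one_units n}"
    using mod_ring.hom_kernels_unitri[OF ring assms(2), of "n - 1"] units n by auto
  then show ?thesis
    using zassenhaus_if_one_units[OF p assms(3)] zassenhaus_carrier[OF prime_ge_2_nat[OF p]] \<mu>_hom
      hom_zassenhaus[OF is_group _ p weight] by blast
qed

text \<open>The kernel for \<open>k\<close> demands divisibility by \<open>p ^ (n - k)\<close> on
  all words up to length \<open>k\<close>, which is sharp only at length \<open>k\<close>; letting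
  \<open>k\<close> vary collects the sharp condition at every length. Words of length
  \<open>n\<close> or more carry the divisor 1. For \<open>n = 1\<close> no \<open>k\<close> occurs
  and the whole group remains.\<close>

lemma hom_kernels_p_central:
  assumes "finite B" "free_group_on S B" "1 \<le> n" and p: "Factorial_Ring.prime p"
  shows "p_central S p n = carrier S \<inter>
    (\<Inter>k\<in>{1..n-1}. hom_kernels S (unitri (residue_ring (int p ^ (n - k))) (k + 1)))"
proof -
  obtain b d \<mu> where M: "magnus_group S b d \<mu>" using free_group_magnus[OF assms(1,2)] by blast
  interpret magnus_group S b d \<mu> by (rule M)
  interpret nc_filtration "pc_weight p" by (rule nc_filtration_pc)
  let ?I = "carrier S \<inter> (\<Inter>k\<in>{1..n-1}. hom_kernels S (unitri (residue_ring (int p ^ (n - k))) (k + 1)))"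
  have kernels: "hom_kernels S (unitri (residue_ring (int p ^ (n - k))) (k + 1))
      = {s \<in> carrier S. \<forall>\<phi>\<in>hom S nc_units.
           \<forall>w. 0 < length w \<and> length w \<le> k \<longrightarrow> int p ^ (n - k) dvd nc_coeff (\<phi> s) w}"
    if "k \<in> {1..n-1}" for k
  proof -
    \<comment> \<open>As \<open>k\<close> stays below \<open>n\<close>, the modulus is a proper
      power of \<open>p\<close> and the residue ring is not trivial.\<close>
    have "1 < int p ^ (n - k)"
      using prime_gt_1_nat[OF p] that assms(3) by (intro one_less_power) auto
    from mod_ring.hom_kernels_unitri[OF mod_ring_residue_ring[OF this] assms(2), of k]
    show ?thesis by simp
  qed
  have units: "\<phi> s \<in> one_units n \<longleftrightarrow> (\<forall>w. 0 < length w \<longrightarrow> int p ^ (n - length w) dvd nc_coeff (\<phi> s) w)"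
    if "\<phi> \<in> hom S nc_units" "s \<in> carrier S" for \<phi> s
    using one_units_iff[of "\<phi> s" n] hom_in_carrier[OF that] by (simp add: pc_weight_def)
  show ?thesis
  proof (intro equalityI subsetI)
    fix s assume s: "s \<in> p_central S p n"
    then have sS: "s \<in> carrier S" by (rule subgroup.mem_carrier[OF p_central_subgroup])
    have "s \<in> hom_kernels S (unitri (residue_ring (int p ^ (n - k))) (k + 1))" if k: "k \<in> {1..n-1}" for k
      unfolding kernels[OF k]
    proof (intro CollectI conjI ballI allI impI sS)
      fix \<phi> and w :: "nat list"
      assume \<phi>: "\<phi> \<in> hom S nc_units" and w: "0 < length w \<and> length w \<le> k"
      have "\<phi> s \<in> one_units n" by (rule hom_p_central[OF is_group \<phi> assms(3) p pc_weight_Suc_dvd s])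
      then have "int p ^ (n - length w) dvd nc_coeff (\<phi> s) w" using units[OF \<phi> sS] w by blast
      moreover have "int p ^ (n - k) dvd int p ^ (n - length w)"
        using w by (intro le_imp_power_dvd diff_le_mono2) blast
      ultimately show "int p ^ (n - k) dvd nc_coeff (\<phi> s) w" by (rule dvd_trans[rotated])
    qed
    then show "s \<in> ?I" using sS by blast
  next
    fix s assume s: "s \<in> ?I"
    then have sS: "s \<in> carrier S" by blast
    have "int p ^ (n - length w) dvd nc_coeff (\<mu> s) w" if w: "0 < length w" for w
    proof (cases "length w \<le> n - 1")
      case True
      then have k: "length w \<in> {1..n-1}" using w unfolding atLeastAtMost_iff by linarith
      have "s \<in> hom_kernels S (unitri (residue_ring (int p ^ (n - length w))) (length w + 1))"
        using s k by blast
      then show ?thesis using \<mu>_hom w unfolding kernels[OF k] by blast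
    qed simp
    then have "\<mu> s \<in> one_units n" using units[OF \<mu>_hom sS] by blast
    then show "s \<in> p_central S p n" by (rule p_central_if_one_units[OF p assms(3) sS])
  qed
qed

theorem theorem2p7:
  fixes S :: "('a, 'b) monoid_scheme" and p n :: nat
  assumes "Factorial_Ring.prime p" and "fg_free_group S" and "n \<ge> 1"
  shows "zassenhaus S p n = hom_kernels S (unitri (residue_ring (int p)) n)
       \<and> lower_central S n = hom_kernels S (unitri \<Z> n)
       \<and> p_central S p n =
           carrier S \<inter> (\<Inter>k\<in>{1..n-1}. hom_kernels S (unitri (residue_ring (int p ^ (n - k))) (k + 1)))"
proof -
  obtain B where B: "finite B" "free_group_on S B" using assms(2) by (auto simp: fg_free_group_def)
  show ?thesis
    using hom_kernels_zassenhaus[OF B assms(3,1)] hom_kernels_lower_central[OF B assms(3)]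
      hom_kernels_p_central[OF B assms(3,1)] by blast
qed

end
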